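(* Let $G$ be a second-countable locally compact non-compact group with left Haar measure $\mu$. Let $S\subset G$, $1\le p<+\infty$, let $\Gamma\subset\mathbb{C}$ be such that $\Gamma\setminus\{0\}$ is non-empty, and let $\omega$ be a locally $p$-integrable $S$-admissible weight on $G$. If the subgroup of $G$ generated by $S$ is abelian, then the following conditions are equivalent: (1) There is a $(\Gamma,S)$-dense vector in $L^p(G,\omega)$. (2) For any compact subset $F\subset G$ and any $\varepsilon>0$, there are $s\in S$, $\lambda\in\Gamma\setminus\{0\}$ and a compact subset $E\subset F$ such that $\mu(F\setminus E)<\varepsilon$ and $$|\lambda|\,\operatorname*{ess\,sup}_{t\in E}\omega(st)<\varepsilon\quad\text{and}\quad\frac1{|\lambda|}\,\operatorname*{ess\,sup}_{t\in E}\omega(s^{-1}t)<\varepsilon.$$ (3) For any compact subset $F\subset G$ and any $\varepsilon>0$, there are $s\in S$, $\lambda\in\Gamma\setminus\{0\}$ and a compact subset $E\subset F$ such that $\mu(F\setminus E)<\varepsilon$ and $$|\lambda|\,\|\omega\|_{p,sE}<\varepsilon\quad\text{and}\quad\frac1{|\lambda|}\,\|\omega\|_{p,s^{-1}E}<\varepsilon.$$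
   Context: A weight on $G$ is a positive measurable function $\omega:G\to(0,+\infty)$; it is locally $p$-integrable if $\int_K\omega^p\,d\mu<+\infty$ for every compact $K\subset G$. $L^p(G,\omega)$ is the space of measurable $f:G\to\mathbb{C}$ (modulo a.e. equality) with $\|f\|_{p,\omega}:=\left(\int_G|f(t)|^p\omega(t)^p\,d\mu(t)\right)^{1/p}<\infty$, with this norm. For $s\in G$, the left translation is $(T_sf)(t)=f(s^{-1}t)$. The weight $\omega$ is $S$-admissible if $M(s):=\operatorname{ess\,sup}_{t\in G}\omega(st)/\omega(t)<+\infty$ for all $s\in S$ (equivalently, $T_s$ is a bounded operator of $L^p(G,\omega)$ into itself for every $s\in S$). A vector $f\in L^p(G,\omega)$ is $(\Gamma,S)$-dense if $\{\lambda T_sf:\ \lambda\in\Gamma,\ s\in S\}$ is dense in $L^p(G,\omega)$. For a measurable function $f$ on $G$ and $K\subset G$, $\|f\|_{p,K}:=\left(\int_K|f(t)|^p\,d\mu(t)\right)^{1/p}$. Essential suprema of $\omega$ over empty or null sets are taken to be $0$. *)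

theory Defs
  imports "HOL-Probability.Essential_Supremum"
begin

text \<open>
  Topological groups are rendered by the type class \<^class>\<open>topological_group_add\<close>. Its addition
  is not assumed commutative: \<open>s + t\<close> stands for \<open>st\<close>, \<open>- s\<close> for the inverse of \<open>s\<close>,
  and \<open>0\<close> for the identity.
\<close>

definition radon_measure :: "'a::topological_space measure \<Rightarrow> bool" where
  "radon_measure M \<longleftrightarrow>
     sets M = sets borel \<and>
     (\<forall>K. compact K \<longrightarrow> emeasure M K < \<infinity>) \<and>
     (\<forall>A\<in>sets borel. emeasure M A = (INF U\<in>{U. open U \<and> A \<subseteq> U}. emeasure M U)) \<and>
     (\<forall>U. open U \<longrightarrow> emeasure M U = (SUP K\<in>{K. compact K \<and> K \<subseteq> U}. emeasure M K))"

definition left_haar_measure :: "'a::topological_group_add measure \<Rightarrow> bool" where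
  "left_haar_measure M \<longleftrightarrow>
     radon_measure M \<and> emeasure M (space M) \<noteq> 0 \<and>
     (\<forall>s. \<forall>A\<in>sets borel. emeasure M ((\<lambda>t. s + t) ` A) = emeasure M A)"

definition is_subgroup :: "'a::group_add set \<Rightarrow> bool" where
  "is_subgroup H \<longleftrightarrow> 0 \<in> H \<and> (\<forall>x\<in>H. \<forall>y\<in>H. x + y \<in> H) \<and> (\<forall>x\<in>H. - x \<in> H)"

definition subgroup_generated_by :: "'a::group_add set \<Rightarrow> 'a set" where
  "subgroup_generated_by S = is_subgroup hull S"

definition is_abelian :: "'a::group_add set \<Rightarrow> bool" where
  "is_abelian H \<longleftrightarrow> (\<forall>x\<in>H. \<forall>y\<in>H. x + y = y + x)"

definition ennreal_powr :: "ennreal \<Rightarrow> real \<Rightarrow> ennreal" where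
  "ennreal_powr x a = (if x = \<infinity> then \<infinity> else ennreal (enn2real x powr a))"

text \<open>
  For a null set \<open>E\<close> the value is \<open>0\<close>, the least element of \<^typ>\<open>ennreal\<close>.
\<close>

definition ess_sup_on :: "'a measure \<Rightarrow> 'a set \<Rightarrow> ('a \<Rightarrow> real) \<Rightarrow> ennreal" where
  "ess_sup_on M E f = esssup (restrict_space M E) (\<lambda>t. ennreal (f t))"

definition p_norm_on :: "'a measure \<Rightarrow> real \<Rightarrow> 'a set \<Rightarrow> ('a \<Rightarrow> 'b::real_normed_vector) \<Rightarrow> ennreal" where
  "p_norm_on M p K f = ennreal_powr (\<integral>\<^sup>+t\<in>K. ennreal (norm (f t) powr p) \<partial>M) (1 / p)"

definition weight :: "'a measure \<Rightarrow> ('a \<Rightarrow> real) \<Rightarrow> bool" where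
  "weight M \<omega> \<longleftrightarrow> \<omega> \<in> borel_measurable M \<and> (\<forall>t. 0 < \<omega> t)"

definition locally_p_integrable ::
  "'a::topological_space measure \<Rightarrow> real \<Rightarrow> ('a \<Rightarrow> real) \<Rightarrow> bool" where
  "locally_p_integrable M p \<omega> \<longleftrightarrow>
     (\<forall>K. compact K \<longrightarrow> (\<integral>\<^sup>+t\<in>K. ennreal (\<omega> t powr p) \<partial>M) < \<infinity>)"

definition admissible_weight ::
  "'a::group_add measure \<Rightarrow> 'a set \<Rightarrow> ('a \<Rightarrow> real) \<Rightarrow> bool" where
  "admissible_weight M S \<omega> \<longleftrightarrow> (\<forall>s\<in>S. ess_sup_on M UNIV (\<lambda>t. \<omega> (s + t) / \<omega> t) < \<infinity>)"

definition weighted_norm ::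
  "'a measure \<Rightarrow> real \<Rightarrow> ('a \<Rightarrow> real) \<Rightarrow> ('a \<Rightarrow> complex) \<Rightarrow> ennreal" where
  "weighted_norm M p \<omega> f =
     ennreal_powr (\<integral>\<^sup>+t. ennreal (norm (f t) powr p * \<omega> t powr p) \<partial>M) (1 / p)"

text \<open>
  Elements of the weighted \<open>L\<^sup>p\<close> space are represented by functions rather than by classes modulo
  a.e.\ equality. Functions that agree a.e.\ are at distance \<open>0\<close>, and left translation
  respects a.e.\ equality, so density of a set of functions in the seminorm is density of the
  corresponding set of classes.
\<close>

definition weighted_Lp ::
  "'a measure \<Rightarrow> real \<Rightarrow> ('a \<Rightarrow> real) \<Rightarrow> ('a \<Rightarrow> complex) set" where
  "weighted_Lp M p \<omega> = {f \<in> borel_measurable M. weighted_norm M p \<omega> f < \<infinity>}"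

definition dense_in_weighted_Lp ::
  "'a measure \<Rightarrow> real \<Rightarrow> ('a \<Rightarrow> real) \<Rightarrow> ('a \<Rightarrow> complex) set \<Rightarrow> bool" where
  "dense_in_weighted_Lp M p \<omega> A \<longleftrightarrow>
     A \<subseteq> weighted_Lp M p \<omega> \<and>
     (\<forall>g\<in>weighted_Lp M p \<omega>. \<forall>\<epsilon>>0. \<exists>h\<in>A. weighted_norm M p \<omega> (\<lambda>t. g t - h t) < ennreal \<epsilon>)"

definition left_translation :: "'a::group_add \<Rightarrow> ('a \<Rightarrow> 'b) \<Rightarrow> 'a \<Rightarrow> 'b" where
  "left_translation s f = (\<lambda>t. f (- s + t))"

definition dense_vector ::
  "'a::group_add measure \<Rightarrow> real \<Rightarrow> ('a \<Rightarrow> real) \<Rightarrow> complex set \<Rightarrow> 'a set \<Rightarrow> ('a \<Rightarrow> complex) \<Rightarrow> bool"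
  where
  "dense_vector M p \<omega> \<Gamma> S f \<longleftrightarrow>
     f \<in> weighted_Lp M p \<omega> \<and>
     dense_in_weighted_Lp M p \<omega> {\<lambda>t. c * left_translation s f t | c s. c \<in> \<Gamma> \<and> s \<in> S}"

end

theory Submission
  imports Defs
begin

text \<open>
  All three conditions are compared with the statement that on most of any compact set both
  \<open>\<bar>c\<bar>\<^sup>p \<nu>(s + E)\<close> and \<open>\<bar>c\<bar>\<^bsup>-p\<^esup> \<nu>(- s + E)\<close> are small, where \<open>\<nu>\<close> has density \<open>\<omega>\<^sup>p\<close>. Chebyshev's inequality
  and inner regularity relate integrals to essential suprema.

  Given a dense vector, first replace it by a multiple of a translate close to the indicator of a
  compact set, and then approximate a multiple of it by a translate. The supports must be almost
  disjoint for both translates to be small where they should be; this is forced by a target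
  function that takes two different values, and room for a second value exists because the group
  is not compact.

  Conversely, a dense vector is the limit of bounded compactly supported functions \<open>u\<^sub>n\<close>, where \<open>u\<^bsub>n+1\<^esub>\<close>
  arises from \<open>u\<^sub>n\<close> by deleting a small piece and adding \<open>c\<^sup>-\<^sup>1 T\<^sub>s\<^sup>-\<^sup>1 h\<^sub>n\<close>, with \<open>h\<^sub>n\<close> running through a
  countable dense set.
\<close>

subsection \<open>Integrals, powers and Borel sets\<close>

text \<open>Exceptional sets are measured by \<mu>, norms by \<nu>. The weight may be unbounded and
  arbitrarily close to 0 on a compact set, so smallness passes between the two measures by absolute
  continuity, in both directions, on compact sets. Norms are replaced by their p-th powers, which
  are integrals against \<nu>; adding two functions then costs a factor \<open>2 powr p\<close>, the
  origin of the recurring constant \<open>2 * 2 powr p\<close>. The obstacle in the construction is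
  that only translations by elements of \<open>S\<close> are known to be bounded, while the
  correction involves an inverse translation. The approximants are therefore kept bounded with
  compact support, a class that every translation preserves, and the inverse translate is estimated
  only on the set \<open>E\<close> that the hypothesis supplies. The obstacle in the other direction
  is that density returns some \<open>s\<close> without saying where it moves a compact set; this
  has to be read off from the values of the approximated functions.\<close>

lemma pos_ennreal_ge_pos_real:
  assumes "0 < (x::ennreal)"
  obtains d :: real where "0 < d" "ennreal d \<le> x"
proof (cases x)
  case (real r)
  then show ?thesis using assms that[of r] by auto
next
  case top
  then show ?thesis using that[of 1] by auto
qed

text \<open>Absolute continuity of the integral: truncation at a suitable height \<open>n\<close>
  leaves a remainder of integral below \<open>e / 2\<close>, and the truncated function contributes
  at most \<open>n\<close> times the measure of \<open>A\<close>.\<close>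

lemma nn_integral_small_on_small_sets:
  fixes f :: "'a \<Rightarrow> ennreal" and e :: real
  assumes f[measurable]: "f \<in> borel_measurable M" and fin: "(\<integral>\<^sup>+x. f x \<partial>M) < \<infinity>" and e: "0 < e"
  shows "\<exists>d>0. \<forall>A\<in>sets M. emeasure M A < ennreal d \<longrightarrow> (\<integral>\<^sup>+x\<in>A. f x \<partial>M) < ennreal e"
proof (cases "(\<integral>\<^sup>+x. f x \<partial>M) < ennreal e")
  case True
  have "(\<integral>\<^sup>+x\<in>A. f x \<partial>M) \<le> (\<integral>\<^sup>+x. f x \<partial>M)" for A
    by (intro nn_integral_mono) (auto split: split_indicator)
  then show ?thesis using True by (intro exI[of _ 1]) (auto intro: le_less_trans)
next
  case False
  define g where "g n x = min (f x) (of_nat n)" for n :: nat and x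
  have [measurable]: "g n \<in> borel_measurable M" for n
    unfolding g_def by measurable
  have sup_g: "(SUP n. g n x) = f x" for x
  proof (rule antisym)
    show "(SUP n. g n x) \<le> f x" by (auto intro!: SUP_least simp: g_def)
    show "f x \<le> (SUP n. g n x)"
    proof (rule dense_le)
      fix y assume y: "y < f x"
      then have "y \<noteq> top" using top.not_eq_extremum less_le_trans[OF y top_greatest] by auto
      then obtain n where "y < of_nat n" using ennreal_Ex_less_of_nat[of y] by (auto simp: less_top)
      then have "y \<le> g n x" using y by (auto simp: g_def)
      also have "\<dots> \<le> (SUP n. g n x)" by (rule SUP_upper) auto
      finally show "y \<le> (SUP n. g n x)" .
    qed
  qed
  have "(\<integral>\<^sup>+x. f x \<partial>M) = (SUP n. \<integral>\<^sup>+x. g n x \<partial>M)"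
    unfolding sup_g[symmetric]
    by (intro nn_integral_monotone_convergence_SUP)
       (auto simp: incseq_def le_fun_def g_def min_def le_max_iff_disj intro: order_trans)
  moreover have "(\<integral>\<^sup>+x. f x \<partial>M) - ennreal (e / 2) < (\<integral>\<^sup>+x. f x \<partial>M)"
    using False fin e by (intro ennreal_between) (auto simp: not_less intro: less_le_trans[of 0 "ennreal e"])
  ultimately obtain n where n: "(\<integral>\<^sup>+x. f x \<partial>M) - ennreal (e / 2) < (\<integral>\<^sup>+x. g n x \<partial>M)"
    by (auto simp: less_SUP_iff)
  have gfin: "(\<integral>\<^sup>+x. g n x \<partial>M) < \<infinity>"
    by (rule le_less_trans[OF _ fin]) (auto intro!: nn_integral_mono simp: g_def)
  have "(\<integral>\<^sup>+x. f x \<partial>M) = (\<integral>\<^sup>+x. g n x + (f x - g n x) \<partial>M)"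
    by (intro nn_integral_cong) (auto simp: g_def intro!: ennreal_ineq_diff_add)
  also have "\<dots> = (\<integral>\<^sup>+x. g n x \<partial>M) + (\<integral>\<^sup>+x. f x - g n x \<partial>M)"
    by (intro nn_integral_add) auto
  finally have split: "(\<integral>\<^sup>+x. f x \<partial>M) = (\<integral>\<^sup>+x. g n x \<partial>M) + (\<integral>\<^sup>+x. f x - g n x \<partial>M)" .
  have "ennreal (e / 2) \<le> (\<integral>\<^sup>+x. f x \<partial>M)"
    using False e by (simp add: not_less) (rule order_trans[of _ "ennreal e"], auto)
  then have "(\<integral>\<^sup>+x. f x \<partial>M) < (\<integral>\<^sup>+x. g n x \<partial>M) + ennreal (e / 2)"
    using n by (simp add: minus_less_iff_ennreal)
  then have rest: "(\<integral>\<^sup>+x. f x - g n x \<partial>M) < ennreal (e / 2)"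
    unfolding split by (simp add: ennreal_add_left_cancel_less)
  \<comment> \<open>In the bound \<open>e / (2 * (real n + 1))\<close> the summand 1 covers
    \<open>n = 0\<close> and makes the contribution of the truncated part strictly less than
    \<open>e / 2\<close>.\<close>
  show ?thesis
  proof (intro exI[of _ "e / (2 * (real n + 1))"] conjI ballI impI)
    show "0 < e / (2 * (real n + 1))" using e by simp
    fix A assume [measurable]: "A \<in> sets M" and A: "emeasure M A < ennreal (e / (2 * (real n + 1)))"
    have "(\<integral>\<^sup>+x\<in>A. f x \<partial>M) \<le> (\<integral>\<^sup>+x. of_nat n * indicator A x + (f x - g n x) \<partial>M)"
    proof (intro nn_integral_mono)
      fix x
      have "f x = g n x + (f x - g n x)" by (intro ennreal_ineq_diff_add) (simp add: g_def)
      also have "\<dots> \<le> of_nat n + (f x - g n x)" by (intro add_right_mono) (simp add: g_def)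
      finally show "f x * indicator A x \<le> of_nat n * indicator A x + (f x - g n x)"
        by (simp split: split_indicator)
    qed
    also have "\<dots> = of_nat n * emeasure M A + (\<integral>\<^sup>+x. f x - g n x \<partial>M)"
      by (subst nn_integral_add) (auto simp: nn_integral_cmult_indicator)
    also have "\<dots> \<le> of_nat n * emeasure M A + ennreal (e / 2)"
      by (intro add_left_mono less_imp_le[OF rest])
    also have "\<dots> < ennreal (e / 2) + ennreal (e / 2)"
    proof -
      have "of_nat n * emeasure M A \<le> ennreal (real n) * ennreal (e / (2 * (real n + 1)))"
        using A by (auto simp: ennreal_of_nat_eq_real_of_nat intro!: mult_left_mono)
      also have "\<dots> = ennreal (real n * (e / (2 * (real n + 1))))" using e by (intro ennreal_mult[symmetric]) auto
      also have "\<dots> < ennreal (e / 2)"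
        using e by (intro ennreal_lessI) (auto simp: field_simps)
      finally show ?thesis by (simp add: add.commute ennreal_add_left_cancel_less)
    qed
    finally show "(\<integral>\<^sup>+x\<in>A. f x \<partial>M) < ennreal e"
      using e by (simp flip: ennreal_plus)
  qed
qed

lemma ennreal_less_divide_if_mult_less:
  fixes x :: ennreal
  assumes "0 < k" "ennreal k * x < ennreal y"
  shows "x < ennreal (y / k)"
proof (rule ccontr)
  assume "\<not> x < ennreal (y / k)"
  then have "ennreal k * ennreal (y / k) \<le> ennreal k * x" by (intro mult_left_mono) auto
  then show False using assms by (simp flip: ennreal_mult')
qed

section \<open>Powers and p-th roots\<close>

lemma powr_inverse_less_iff:
  fixes r e p :: real
  assumes "0 < p" "0 \<le> r" "0 \<le> e"
  shows "r powr (1 / p) < e \<longleftrightarrow> r < e powr p"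
proof
  assume "r powr (1 / p) < e"
  then have "(r powr (1 / p)) powr p < e powr p" using assms by (intro powr_less_mono2) auto
  then show "r < e powr p" using assms by (simp add: powr_powr)
next
  assume "r < e powr p"
  then have "r powr (1 / p) < (e powr p) powr (1 / p)" using assms by (intro powr_less_mono2) auto
  then show "r powr (1 / p) < e" using assms by (simp add: powr_powr)
qed

text \<open>Passage from norms to p-th powers. It includes \<open>x = \<infinity>\<close>, where
  both inequalities fail because \<open>a\<close> is positive.\<close>

lemma scaled_ennreal_powr_inverse_less_iff:
  assumes "0 < p" "0 < e" "0 < a"
  shows "ennreal a * ennreal_powr x (1 / p) < ennreal e \<longleftrightarrow> ennreal (a powr p) * x < ennreal (e powr p)"
proof (cases x)
  case (real r)
  have "a * r powr (1 / p) < e \<longleftrightarrow> r powr (1 / p) < e / a"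
    using assms by (simp add: field_simps)
  also have "\<dots> \<longleftrightarrow> r < (e / a) powr p"
    using assms real by (intro powr_inverse_less_iff) auto
  also have "\<dots> \<longleftrightarrow> a powr p * r < e powr p"
    using assms by (simp add: powr_divide field_simps)
  finally show ?thesis
    using real assms by (simp add: ennreal_powr_def ennreal_less_iff flip: ennreal_mult)
next
  case top
  then show ?thesis using assms by (simp add: ennreal_powr_def ennreal_mult_top)
qed

lemma ennreal_powr_inverse_less_iff:
  assumes "0 < p" "0 < e"
  shows "ennreal_powr x (1 / p) < ennreal e \<longleftrightarrow> x < ennreal (e powr p)"
  using scaled_ennreal_powr_inverse_less_iff[OF assms, of 1 x] by simp

text \<open>The crude bound by twice the larger of the two norms gives a triangle inequality for
  p-th powers up to a constant; it takes the place of Minkowski's inequality.\<close>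

lemma norm_add_powr_le:
  fixes a b :: "'b::real_normed_vector"
  assumes "0 < p"
  shows "norm (a + b) powr p \<le> 2 powr p * (norm a powr p + norm b powr p)"
proof -
  have "norm (a + b) \<le> 2 * max (norm a) (norm b)"
    using norm_triangle_ineq[of a b] by linarith
  then have "norm (a + b) powr p \<le> (2 * max (norm a) (norm b)) powr p"
    using assms by (intro powr_mono2) auto
  also have "\<dots> = 2 powr p * max (norm a) (norm b) powr p"
    by (simp add: powr_mult)
  also have "\<dots> \<le> 2 powr p * (norm a powr p + norm b powr p)"
    by (intro mult_left_mono) (auto simp: max_def)
  finally show ?thesis .
qed

text \<open>
  With \<open>y\<^sub>m = x\<^bsub>m+1\<^esub> - x\<^sub>m\<close> one has \<open>\<bar>y\<^sub>m\<bar> \<le> 2\<^bsup>-m\<^esup> R\<close> where \<open>R\<^sup>p\<close> is the sum on the right, so no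
  triangle inequality for the \<open>p\<close>-norm is needed to sum the increments.
\<close>

lemma norm_lim_diff_powr_le:
  fixes x :: "nat \<Rightarrow> 'b::banach"
  assumes p: "0 < p"
  shows "ennreal (norm (lim x - x 0) powr p)
    \<le> ennreal (2 powr p) * (\<Sum>m. ennreal (2 powr (real m * p)) * ennreal (norm (x (Suc m) - x m) powr p))"
    (is "_ \<le> _ * ?s")
proof (cases ?s)
  \<comment> \<open>Where the series diverges, \<open>lim x\<close> may be an arbitrary value, but
    then the right-hand side is infinite.\<close>
  case top
  then show ?thesis by (simp add: ennreal_mult_top)
next
  case (real r)
  define R where "R = r powr (1 / p)"
  have R: "R powr p = r" "0 \<le> R" using p real by (auto simp: R_def powr_powr)
  have bound: "norm (x (Suc m) - x m) \<le> R * (1/2) ^ m" for m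
  proof -
    have "ennreal (2 powr (real m * p)) * ennreal (norm (x (Suc m) - x m) powr p) \<le> ?s"
      by (rule sum_le_suminf[of _ "{m}", simplified]) auto
    then have "(2 ^ m * norm (x (Suc m) - x m)) powr p \<le> R powr p"
      using real R by (simp add: powr_mult powr_powr flip: ennreal_mult powr_realpow)
    then have "2 ^ m * norm (x (Suc m) - x m) \<le> R"
      using powr_less_mono2[OF p R(2), of "2 ^ m * norm (x (Suc m) - x m)"] by linarith
    then show ?thesis by (simp add: field_simps)
  qed
  have sm: "summable (\<lambda>m. x (Suc m) - x m)"
    by (rule summable_comparison_test'[OF _ bound]) (auto intro!: summable_mult summable_geometric)
  then have "(\<lambda>n. x n - x 0 + x 0) \<longlonglongrightarrow> (\<Sum>m. x (Suc m) - x m) + x 0"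
    using summable_LIMSEQ[OF sm] by (intro tendsto_add) (simp_all add: sum_lessThan_telescope)
  then have "convergent x" by (auto simp: convergent_def)
  then have lim: "x \<longlonglongrightarrow> lim x" by (simp add: convergent_LIMSEQ_iff)
  have "norm (x n - x 0) \<le> 2 * R" for n
  proof -
    have "norm (x n - x 0) = norm (\<Sum>m<n. x (Suc m) - x m)" by (simp add: sum_lessThan_telescope)
    also have "\<dots> \<le> (\<Sum>m<n. R * (1/2) ^ m)" by (intro sum_norm_le bound)
    also have "\<dots> \<le> (\<Sum>m. R * (1/2) ^ m)"
      using R by (intro sum_le_suminf summable_mult summable_geometric) auto
    also have "\<dots> = 2 * R"
      by (subst suminf_mult) (auto simp: suminf_geometric)
    finally show ?thesis .
  qed
  then have "norm (lim x - x 0) \<le> 2 * R"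
    by (intro tendsto_upperbound[OF tendsto_norm[OF tendsto_diff[OF lim tendsto_const[of "x 0"]]]]) auto
  then have "norm (lim x - x 0) powr p \<le> (2 * R) powr p"
    using p by (intro powr_mono2) auto
  also have "\<dots> = 2 powr p * r" using R by (simp add: powr_mult)
  finally have "norm (lim x - x 0) powr p \<le> 2 powr p * r" .
  then show ?thesis unfolding real(2) using real(1) by (simp add: ennreal_leI flip: ennreal_mult)
qed

text \<open>Makes a translate the preimage of a set under a continuous map, so that openness and
  measurability pass to translates.\<close>

lemma vimage_add_left: "(\<lambda>t. s + t) -` A = (\<lambda>t. - s + t) ` A" for s :: "'a::group_add"
proof safe
  fix t assume "s + t \<in> A"
  then show "t \<in> (\<lambda>t. - s + t) ` A" by (intro image_eqI[of _ _ "s + t"]) (simp_all add: add.assoc[symmetric])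
qed (simp add: add.assoc[symmetric])

lemma compact_translate:
  fixes A :: "'a::topological_group_add set"
  shows "compact A \<Longrightarrow> compact ((\<lambda>t. s + t) ` A)"
  by (intro compact_continuous_image continuous_intros)

lemma abelian_generated_commute:
  assumes "is_abelian (subgroup_generated_by S)" "s \<in> S" "t \<in> S"
  shows "s + t = t + s"
proof -
  have "S \<subseteq> subgroup_generated_by S"
    unfolding subgroup_generated_by_def by (rule hull_subset)
  then show ?thesis using assms by (auto simp: is_abelian_def)
qed

text \<open>True also for divergent sequences: both limits are chosen by equivalent predicates,
  hence even the default values agree.\<close>

lemma lim_shift: "lim (\<lambda>m. x (N + m)) = lim x" for x :: "nat \<Rightarrow> 'b::t2_space"
proof -
  have "(\<lambda>m. x (N + m)) \<longlonglongrightarrow> l \<longleftrightarrow> x \<longlonglongrightarrow> l" for l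
    using LIMSEQ_ignore_initial_segment[of x l N] LIMSEQ_offset[of x N l] by (auto simp: add.commute)
  then show ?thesis by (simp add: lim_def)
qed

text \<open>The finite intersections of members of a countable base; the empty intersection supplies
  \<open>UNIV\<close>. Stability under intersections serves the later Dynkin argument, countability
  serves separability.\<close>

lemma countable_pi_system_borel:
  obtains P :: "'a::second_countable_topology set set" where
    "countable P" "Int_stable P" "UNIV \<in> P" "P \<subseteq> sets borel" "sigma_sets UNIV P = sets borel"
proof -
  obtain B :: "'a set set" where B: "countable B" "topological_basis B"
    using ex_countable_basis by blast
  define P where "P = Inter ` {F. finite F \<and> F \<subseteq> B}"
  have B_borel: "B \<subseteq> sets borel" using topological_basis_open[OF B(2)] by auto
  have P_borel: "P \<subseteq> sets borel"
  proof
    fix X assume "X \<in> P"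
    then obtain F where F: "finite F" "F \<subseteq> B" "X = \<Inter>F" by (auto simp: P_def)
    have "open (\<Inter>F)" using F topological_basis_open[OF B(2)] by (intro open_Inter) auto
    then show "X \<in> sets borel" using F by simp
  qed
  show ?thesis
  proof
    show "countable P" unfolding P_def using B(1) by (intro countable_image countable_Collect_finite_subset)
    show "Int_stable P"
    proof (rule Int_stableI)
      fix X Y assume "X \<in> P" "Y \<in> P"
      then obtain F G where FG: "finite F" "F \<subseteq> B" "X = \<Inter>F" "finite G" "G \<subseteq> B" "Y = \<Inter>G"
        by (auto simp: P_def)
      then have "X \<inter> Y = \<Inter>(F \<union> G)" "finite (F \<union> G)" "F \<union> G \<subseteq> B" by auto
      then show "X \<inter> Y \<in> P" unfolding P_def by blast
    qed
    show "UNIV \<in> P" unfolding P_def by (intro image_eqI[of _ _ "{}"]) auto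
    show "P \<subseteq> sets borel" by (rule P_borel)
    have "B \<subseteq> P"
    proof
      fix b assume "b \<in> B"
      then show "b \<in> P" unfolding P_def by (intro image_eqI[of _ _ "{b}"]) auto
    qed
    moreover have "sets borel = sigma_sets UNIV B"
      by (subst borel_eq_countable_basis[OF B]) simp
    ultimately show "sigma_sets UNIV P = sets borel"
      using P_borel sigma_sets_mono[of P UNIV B] sigma_sets_mono'[of B P UNIV] by auto
  qed
qed

subsection \<open>The weighted Haar measure\<close>

locale weighted_group =
  fixes \<mu> :: "'a::{topological_group_add, t2_space, second_countable_topology} measure"
    and p :: real and \<omega> :: "'a \<Rightarrow> real"
  assumes locally_compact: "locally_compact_space (euclidean :: 'a topology)"
    and haar: "left_haar_measure \<mu>"
    and p_pos: "0 < p"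
    and weight: "weight \<mu> \<omega>"
    and locally_integrable: "locally_p_integrable \<mu> p \<omega>"
begin

lemma sets_haar[measurable_cong, simp]: "sets \<mu> = sets borel"
  using haar by (simp add: left_haar_measure_def radon_measure_def)

lemma space_haar[simp]: "space \<mu> = UNIV"
  using sets_eq_imp_space_eq[OF sets_haar] by simp

lemma weight_measurable[measurable]: "\<omega> \<in> borel_measurable borel"
  using weight by (simp add: weight_def cong: measurable_cong_sets)

lemma weight_pos: "0 < \<omega> t"
  using weight by (simp add: weight_def)

lemma emeasure_compact_finite: "compact K \<Longrightarrow> emeasure \<mu> K < \<infinity>"
  using haar by (simp add: left_haar_measure_def radon_measure_def)

lemma emeasure_translate: "A \<in> sets borel \<Longrightarrow> emeasure \<mu> ((\<lambda>t. s + t) ` A) = emeasure \<mu> A"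
  using haar by (simp add: left_haar_measure_def)

lemma translate_borel[measurable]: "A \<in> sets borel \<Longrightarrow> (\<lambda>t. s + t) ` A \<in> sets borel"
  for s :: 'a
proof -
  assume [measurable]: "A \<in> sets borel"
  have "(\<lambda>t. - s + t) -` A \<in> sets borel"
    by (rule measurable_sets_borel[of _ borel]) measurable
  then show ?thesis by (simp add: vimage_add_left)
qed

lemma nn_integral_translate:
  assumes [measurable]: "f \<in> borel_measurable borel"
  shows "(\<integral>\<^sup>+t. f (s + t) \<partial>\<mu>) = (\<integral>\<^sup>+t. f t \<partial>\<mu>)"
proof -
  have "distr \<mu> \<mu> (\<lambda>t. s + t) = \<mu>"
  proof (rule measure_eqI)
    fix A assume "A \<in> sets (distr \<mu> \<mu> ((+) s))"
    then show "emeasure (distr \<mu> \<mu> (\<lambda>t. s + t)) A = emeasure \<mu> A"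
      by (subst emeasure_distr) (auto simp: vimage_add_left emeasure_translate)
  qed simp
  then have "(\<integral>\<^sup>+t. f t \<partial>\<mu>) = (\<integral>\<^sup>+t. f t \<partial>distr \<mu> \<mu> (\<lambda>t. s + t))" by simp
  also have "\<dots> = (\<integral>\<^sup>+t. f (s + t) \<partial>\<mu>)" by (rule nn_integral_distr) auto
  finally show ?thesis by simp
qed

text \<open>The measure \<nu> of the overview. Weighted norms are unweighted p-norms for it, so the
  weight becomes visible only when something is translated.\<close>

definition weighted_measure :: "'a measure" where
  "weighted_measure = density \<mu> (\<lambda>t. ennreal (\<omega> t powr p))"

lemma sets_weighted_measure[measurable_cong, simp]: "sets weighted_measure = sets borel"
  by (simp add: weighted_measure_def)

lemma space_weighted_measure[simp]: "space weighted_measure = UNIV"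
  by (simp add: weighted_measure_def)

lemma nn_integral_weighted_measure:
  assumes "f \<in> borel_measurable borel"
  shows "(\<integral>\<^sup>+t. f t \<partial>weighted_measure) = (\<integral>\<^sup>+t. ennreal (\<omega> t powr p) * f t \<partial>\<mu>)"
  using assms unfolding weighted_measure_def by (intro nn_integral_density) auto

lemma emeasure_weighted_measure:
  "A \<in> sets borel \<Longrightarrow> emeasure weighted_measure A = (\<integral>\<^sup>+t\<in>A. ennreal (\<omega> t powr p) \<partial>\<mu>)"
  unfolding weighted_measure_def by (intro emeasure_density) auto

lemma emeasure_weighted_measure_compact:
  "compact K \<Longrightarrow> emeasure weighted_measure K < \<infinity>"
  using locally_integrable
  by (subst emeasure_weighted_measure) (auto simp: borel_compact locally_p_integrable_def)

text \<open>Left invariance moves the translation from the set to the weight. This links integrals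
  of the weight over a translate of \<open>A\<close> with the values \<open>\<omega> (s + t)\<close>
  for \<open>t\<close> in \<open>A\<close>, of which the essential suprema speak.\<close>

lemma emeasure_weighted_measure_translate:
  assumes [measurable]: "A \<in> sets borel"
  shows "emeasure weighted_measure ((\<lambda>t. s + t) ` A) = (\<integral>\<^sup>+t\<in>A. ennreal (\<omega> (s + t) powr p) \<partial>\<mu>)"
proof -
  have "emeasure weighted_measure ((\<lambda>t. s + t) ` A)
      = (\<integral>\<^sup>+t. ennreal (\<omega> t powr p) * indicator ((\<lambda>t. s + t) ` A) t \<partial>\<mu>)"
    by (subst emeasure_weighted_measure) auto
  also have "\<dots> = (\<integral>\<^sup>+t. ennreal (\<omega> (s + t) powr p) * indicator ((\<lambda>t. s + t) ` A) (s + t) \<partial>\<mu>)"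
    by (rule nn_integral_translate[symmetric]) measurable
  also have "\<dots> = (\<integral>\<^sup>+t\<in>A. ennreal (\<omega> (s + t) powr p) \<partial>\<mu>)"
    by (intro nn_integral_cong) (auto split: split_indicator)
  finally show ?thesis .
qed

section \<open>Comparison of the two measures on compact sets\<close>

lemma weighted_measure_small:
  assumes F: "compact F" and e: "0 < e"
  shows "\<exists>d>0. \<forall>A\<in>sets borel. A \<subseteq> F \<longrightarrow> emeasure \<mu> A < ennreal d \<longrightarrow>
    emeasure weighted_measure A < ennreal e"
proof -
  have [measurable]: "F \<in> sets borel" using F by (rule borel_compact)
  have "(\<integral>\<^sup>+t\<in>F. ennreal (\<omega> t powr p) \<partial>\<mu>) < \<infinity>"
    using locally_integrable F by (simp add: locally_p_integrable_def)
  from nn_integral_small_on_small_sets[OF _ this e]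
  obtain d where d: "0 < d" "\<And>A. A \<in> sets borel \<Longrightarrow> emeasure \<mu> A < ennreal d \<Longrightarrow>
      (\<integral>\<^sup>+t\<in>A. ennreal (\<omega> t powr p) * indicator F t \<partial>\<mu>) < ennreal e"
    by auto
  have "emeasure weighted_measure A < ennreal e"
    if "A \<in> sets borel" "A \<subseteq> F" "emeasure \<mu> A < ennreal d" for A
  proof -
    have "emeasure weighted_measure A = (\<integral>\<^sup>+t\<in>A. ennreal (\<omega> t powr p) * indicator F t \<partial>\<mu>)"
      using that by (auto simp: emeasure_weighted_measure split: split_indicator intro!: nn_integral_cong)
    then show ?thesis using d(2) that by simp
  qed
  then show ?thesis using d(1) by blast
qed

text \<open>The density of \<mu> with respect to \<nu> is the reciprocal of
  \<open>\<omega> t powr p\<close>. Although it may be unbounded on \<open>F\<close>, its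
  \<nu>-integral over \<open>F\<close> is the finite number \<open>emeasure \<mu> F\<close>, so
  absolute continuity of the integral applies.\<close>

lemma haar_measure_small:
  assumes F: "compact F" and e: "0 < e"
  shows "\<exists>d>0. \<forall>A\<in>sets borel. A \<subseteq> F \<longrightarrow> emeasure weighted_measure A < ennreal d \<longrightarrow>
    emeasure \<mu> A < ennreal e"
proof -
  have [measurable]: "F \<in> sets borel" using F by (rule borel_compact)
  have cancel: "ennreal (\<omega> t powr p) * (ennreal (1 / \<omega> t powr p) * x) = x" for t x
    using weight_pos[of t] by (simp flip: mult.assoc ennreal_mult)
  have inv: "(\<integral>\<^sup>+t\<in>A. ennreal (1 / \<omega> t powr p) * indicator F t \<partial>weighted_measure) = emeasure \<mu> A"
    if [measurable]: "A \<in> sets borel" and "A \<subseteq> F" for A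
  proof -
    have "(\<integral>\<^sup>+t\<in>A. ennreal (1 / \<omega> t powr p) * indicator F t \<partial>weighted_measure)
      = (\<integral>\<^sup>+t. ennreal (\<omega> t powr p) * (ennreal (1 / \<omega> t powr p) * indicator F t * indicator A t) \<partial>\<mu>)"
      by (rule nn_integral_weighted_measure) measurable
    also have "\<dots> = (\<integral>\<^sup>+t. indicator A t \<partial>\<mu>)"
      using \<open>A \<subseteq> F\<close> cancel[of _ 1] by (intro nn_integral_cong) (auto split: split_indicator)
    finally show ?thesis by simp
  qed
  have "(\<integral>\<^sup>+t\<in>F. ennreal (1 / \<omega> t powr p) \<partial>weighted_measure)
      = (\<integral>\<^sup>+t\<in>F. ennreal (1 / \<omega> t powr p) * indicator F t \<partial>weighted_measure)"
    by (intro nn_integral_cong) (auto split: split_indicator)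
  then have "(\<integral>\<^sup>+t\<in>F. ennreal (1 / \<omega> t powr p) \<partial>weighted_measure) < \<infinity>"
    using inv[of F] emeasure_compact_finite[OF F] by simp
  from nn_integral_small_on_small_sets[OF _ this e]
  obtain d where d: "0 < d" "\<And>A. A \<in> sets borel \<Longrightarrow> emeasure weighted_measure A < ennreal d \<Longrightarrow>
      (\<integral>\<^sup>+t\<in>A. ennreal (1 / \<omega> t powr p) * indicator F t \<partial>weighted_measure) < ennreal e"
    by auto
  then have "emeasure \<mu> A < ennreal e"
    if "A \<in> sets borel" "A \<subseteq> F" "emeasure weighted_measure A < ennreal d" for A
    using d(2)[OF that(1,3)] inv[OF that(1,2)] by simp
  then show ?thesis using d(1) by blast
qed

text \<open>\<open>radon_measure\<close> gives inner regularity for open sets and outer regularity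
  for Borel sets. The latter, applied to \<open>F - A\<close>, yields an open \<open>U\<close> of
  little excess measure; \<open>F - U\<close> is compact, and what it misses of \<open>A\<close>
  lies in that excess.\<close>

lemma compact_inner_approximation:
  assumes F: "compact F" and A[measurable]: "A \<in> sets borel" and AF: "A \<subseteq> F" and e: "0 < e"
  obtains E where "compact E" "E \<subseteq> A" "emeasure \<mu> (A - E) < ennreal e"
proof -
  have [measurable]: "F \<in> sets borel" using F by (rule borel_compact)
  have fin: "emeasure \<mu> B < \<infinity>" if "B \<subseteq> F" "B \<in> sets borel" for B
    using emeasure_mono[of B F \<mu>] emeasure_compact_finite[OF F] that by (auto intro: le_less_trans)
  have "emeasure \<mu> (F - A) = (INF U\<in>{U. open U \<and> F - A \<subseteq> U}. emeasure \<mu> U)"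
    using haar by (simp add: left_haar_measure_def radon_measure_def)
  moreover have "emeasure \<mu> (F - A) < emeasure \<mu> (F - A) + ennreal e"
    using fin[of "F - A"] e by (simp add: ennreal_add_left_cancel_less[of _ 0, simplified])
  ultimately obtain U where U: "open U" "F - A \<subseteq> U" "emeasure \<mu> U < emeasure \<mu> (F - A) + ennreal e"
    by (auto simp: INF_less_iff)
  have [measurable]: "U \<in> sets borel" using U(1) by simp
  show ?thesis
  proof
    show "compact (F - U)" using F U(1) by (rule compact_diff)
    show "F - U \<subseteq> A" using U(2) by auto
    have "emeasure \<mu> (F - A) + emeasure \<mu> (A - (F - U)) = emeasure \<mu> ((F - A) \<union> (A - (F - U)))"
      by (intro plus_emeasure) auto
    also have "\<dots> \<le> emeasure \<mu> U"
      using U(2) AF by (intro emeasure_mono) auto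
    also have "\<dots> < emeasure \<mu> (F - A) + ennreal e" by (rule U(3))
    finally show "emeasure \<mu> (A - (F - U)) < ennreal e"
      by (simp add: ennreal_add_left_cancel_less)
  qed
qed

text \<open>By local compactness the members of a countable base that lie in some compact set still
  cover the group; finite unions of compact sets containing them form the exhaustion.\<close>

lemma compact_exhaustion:
  obtains K :: "nat \<Rightarrow> 'a set" where "\<forall>n. compact (K n)" "incseq K" "(\<Union>n. K n) = UNIV"
proof -
  obtain B :: "'a set set" where B: "countable B" "topological_basis B"
    using ex_countable_basis by blast
  define C where "C = {b\<in>B. \<exists>k. compact k \<and> b \<subseteq> k}"
  have "countable C" using B by (auto simp: C_def)
  have C: "\<exists>k. compact k \<and> b \<subseteq> k" if "b \<in> C" for b using that by (auto simp: C_def)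
  have cover: "\<exists>b\<in>C. x \<in> b" for x
  proof -
    obtain U k where U: "open U" "compact k" "x \<in> U" "U \<subseteq> k"
      using locally_compact by (auto simp: locally_compact_space_def) metis
    then obtain b where "b \<in> B" "x \<in> b" "b \<subseteq> U"
      using B(2) by (meson topological_basisE)
    then show ?thesis using U by (auto simp: C_def)
  qed
  then have "C \<noteq> {}" by blast
  define k where "k b = (SOME k. compact k \<and> b \<subseteq> k)" for b :: "'a set"
  have k: "compact (k b)" "b \<subseteq> k b" if "b \<in> C" for b
    using someI_ex[OF C[OF that]] by (auto simp: k_def)
  define K where "K n = (\<Union>i\<le>n. k (from_nat_into C i))" for n
  have fC: "from_nat_into C i \<in> C" for i using \<open>C \<noteq> {}\<close> by (rule from_nat_into)
  show ?thesis
  proof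
    show "\<forall>n. compact (K n)" unfolding K_def using k fC by (intro allI compact_UN) auto
    show "incseq K" by (force simp: incseq_def K_def)
    show "(\<Union>n. K n) = UNIV"
    proof safe
      fix x
      obtain b where b: "b \<in> C" "x \<in> b" using cover by blast
      then obtain i where "from_nat_into C i = b"
        using from_nat_into_surj[OF \<open>countable C\<close>] by blast
      then have "x \<in> K i" using k[OF b(1)] b(2) by (auto simp: K_def)
      then show "x \<in> (\<Union>n. K n)" by blast
    qed simp
  qed
qed

lemma emeasure_zero_if_compact_parts_zero:
  assumes A[measurable]: "A \<in> sets borel" and z: "\<And>K. compact K \<Longrightarrow> emeasure \<mu> (K \<inter> A) = 0"
  shows "emeasure \<mu> A = 0"
proof -
  obtain K :: "nat \<Rightarrow> 'a set" where K: "\<forall>n. compact (K n)" "incseq K" "(\<Union>n. K n) = UNIV"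
    by (rule compact_exhaustion)
  have "emeasure \<mu> (\<Union>n. K n \<inter> A) = 0"
    using K(1) A by (intro emeasure_UN_eq_0 z) (auto intro!: sets.Int[OF borel_compact])
  moreover have "(\<Union>n. K n \<inter> A) = A"
    using K(3) by (simp flip: Int_UN_distrib2 add: Int_commute)
  ultimately show ?thesis by simp
qed

lemma emeasure_UNIV_pos: "emeasure \<mu> UNIV \<noteq> 0"
  using haar by (simp add: left_haar_measure_def)

text \<open>Finitely many translates of \<open>U\<close> cover a given compact set. If
  \<open>U\<close> were null, every compact set would be null, and so would the whole group.\<close>

lemma emeasure_open_pos:
  assumes U: "open U" "U \<noteq> {}"
  shows "0 < emeasure \<mu> U"
proof (rule ccontr)
  assume "\<not> 0 < emeasure \<mu> U"
  then have zero: "emeasure \<mu> U = 0" by simp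
  obtain u where u: "u \<in> U" using U by blast
  have "emeasure \<mu> (K \<inter> UNIV) = 0" if K: "compact K" for K
  proof -
    have "open ((\<lambda>t. s + t) ` U)" for s
    proof -
      have "open ((\<lambda>t. - s + t) -` U)" by (intro open_vimage U continuous_intros)
      then show ?thesis by (simp add: vimage_add_left)
    qed
    \<comment> \<open>Left addition of \<open>s - u\<close> carries the point \<open>u\<close> of
      \<open>U\<close> to \<open>s\<close>, so the translate indexed by \<open>s\<close> contains
      \<open>s\<close>.\<close>
    moreover have "K \<subseteq> (\<Union>s\<in>K. (\<lambda>t. s - u + t) ` U)"
    proof
      fix t assume "t \<in> K"
      moreover have "t \<in> (\<lambda>x. t - u + x) ` U"
        using u by (intro image_eqI[of _ _ u]) auto
      ultimately show "t \<in> (\<Union>s\<in>K. (\<lambda>t. s - u + t) ` U)" by blast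
    qed
    ultimately obtain D where D: "D \<subseteq> K" "finite D" "K \<subseteq> (\<Union>s\<in>D. (\<lambda>t. s - u + t) ` U)"
      by (rule compactE_image[OF K]) auto
    have "emeasure \<mu> K \<le> emeasure \<mu> (\<Union>s\<in>D. (\<lambda>t. s - u + t) ` U)"
      using D U by (intro emeasure_mono) auto
    also have "\<dots> \<le> (\<Sum>s\<in>D. emeasure \<mu> ((\<lambda>t. s - u + t) ` U))"
      using D(2) U by (intro emeasure_subadditive_finite) auto
    also have "\<dots> = 0" using U zero by (simp add: emeasure_translate)
    finally show ?thesis by simp
  qed
  then show False using emeasure_zero_if_compact_parts_zero[of UNIV] emeasure_UNIV_pos by simp
qed

text \<open>Joining \<open>K\<close> to \<open>F\<close> makes the measure of \<open>A\<close>
  positive even if \<open>F\<close> is null. The complement of \<open>A\<close> is open, and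
  non-empty because the group is not compact; having positive measure, it meets some compact
  \<open>L\<close> in a set of positive measure.\<close>

lemma compact_extension:
  assumes nc: "\<not> compact (UNIV :: 'a set)" and F: "compact F"
  obtains A B where "compact A" "compact B" "F \<subseteq> A" "A \<subseteq> B"
    "0 < emeasure \<mu> A" "0 < emeasure \<mu> (B - A)"
proof -
  obtain K where K: "compact K" "0 < emeasure \<mu> K"
    using emeasure_zero_if_compact_parts_zero[of UNIV] emeasure_UNIV_pos by (auto simp: zero_less_iff_neq_zero)
  define A where "A = F \<union> K"
  have A: "compact A" using F K by (auto simp: A_def)
  have [measurable]: "A \<in> sets borel" using A by (rule borel_compact)
  have "A \<noteq> UNIV" using nc A by auto
  moreover have "open (- A)" using compact_imp_closed[OF A] by (rule open_Compl)
  ultimately have "0 < emeasure \<mu> (- A)" by (intro emeasure_open_pos) auto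
  then obtain L where L: "compact L" "0 < emeasure \<mu> (L \<inter> - A)"
    using emeasure_zero_if_compact_parts_zero[of "- A"] by (auto simp: zero_less_iff_neq_zero)
  show ?thesis
  proof
    show "compact A" "F \<subseteq> A" "A \<subseteq> A \<union> L" "compact (A \<union> L)" using A L by (auto simp: A_def)
    have "emeasure \<mu> K \<le> emeasure \<mu> A" by (intro emeasure_mono) (auto simp: A_def[symmetric], auto simp: A_def)
    then show "0 < emeasure \<mu> A" using K(2) by (rule less_le_trans[rotated])
    have "(A \<union> L) - A = L \<inter> - A" by auto
    then show "0 < emeasure \<mu> ((A \<union> L) - A)" using L(2) by simp
  qed
qed

subsection \<open>The modular of the weighted space\<close>

lemma p_norm_on_less_iff:
  assumes "compact E" "0 < a" "0 < e"
  shows "ennreal a * p_norm_on \<mu> p ((\<lambda>t. s + t) ` E) \<omega> < ennreal e \<longleftrightarrow>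
    ennreal (a powr p) * emeasure weighted_measure ((\<lambda>t. s + t) ` E) < ennreal (e powr p)"
proof -
  have [measurable]: "E \<in> sets borel" using assms by (intro borel_compact)
  have "(\<integral>\<^sup>+t\<in>(\<lambda>t. s + t) ` E. ennreal (norm (\<omega> t) powr p) \<partial>\<mu>)
      = emeasure weighted_measure ((\<lambda>t. s + t) ` E)"
    using weight_pos by (simp add: emeasure_weighted_measure less_imp_le)
  then show ?thesis
    using assms p_pos by (simp add: p_norm_on_def scaled_ennreal_powr_inverse_less_iff)
qed

lemma ess_sup_on_le:
  assumes "compact E" and le: "\<And>t. t \<in> E \<Longrightarrow> a * \<omega> (s + t) \<le> e" and "0 < a"
  shows "ennreal a * ess_sup_on \<mu> E (\<lambda>t. \<omega> (s + t)) \<le> ennreal e"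
proof -
  have [measurable]: "E \<in> sets \<mu>" using assms by (simp add: borel_compact)
  have "ess_sup_on \<mu> E (\<lambda>t. \<omega> (s + t)) \<le> ennreal (e / a)"
    unfolding ess_sup_on_def
  proof (rule esssup_I)
    have "(\<lambda>t. ennreal (\<omega> (s + t))) \<in> borel_measurable \<mu>" by measurable
    then show "(\<lambda>t. ennreal (\<omega> (s + t))) \<in> borel_measurable (restrict_space \<mu> E)"
      by (rule measurable_restrict_space1)
    show "AE t in restrict_space \<mu> E. ennreal (\<omega> (s + t)) \<le> ennreal (e / a)"
      using le \<open>0 < a\<close>
      by (intro AE_I2) (auto simp: space_restrict_space field_simps intro!: ennreal_leI)
  qed
  then have "ennreal a * ess_sup_on \<mu> E (\<lambda>t. \<omega> (s + t)) \<le> ennreal a * ennreal (e / a)"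
    by (intro mult_left_mono) auto
  also have "\<dots> = ennreal e" using \<open>0 < a\<close> by (simp flip: ennreal_mult')
  finally show ?thesis .
qed

lemma weighted_measure_le_ess_sup_on:
  assumes E: "compact E" and a: "0 < a" and e: "0 < e"
    and less: "ennreal a * ess_sup_on \<mu> E (\<lambda>t. \<omega> (s + t)) < ennreal e"
  shows "ennreal (a powr p) * emeasure weighted_measure ((\<lambda>t. s + t) ` E) \<le> ennreal (e powr p) * emeasure \<mu> E"
proof -
  have [measurable]: "E \<in> sets borel" using E by (rule borel_compact)
  let ?M = "ess_sup_on \<mu> E (\<lambda>t. \<omega> (s + t))"
  have "?M \<noteq> top" using less a by (auto simp: ennreal_mult_top)
  then obtain m where m: "0 \<le> m" "?M = ennreal m" by (cases ?M) auto
  have am: "a * m < e" using less a e m by (simp add: ennreal_less_iff flip: ennreal_mult)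
  have "AE t in restrict_space \<mu> E. ennreal (\<omega> (s + t)) \<le> ennreal m"
    using esssup_AE[where M = "restrict_space \<mu> E" and f = "\<lambda>t. ennreal (\<omega> (s + t))"] m by (simp add: ess_sup_on_def)
  then have "AE t in \<mu>. t \<in> E \<longrightarrow> \<omega> (s + t) \<le> m"
    using m by (subst (asm) AE_restrict_space_iff) auto
  then have "emeasure weighted_measure ((\<lambda>t. s + t) ` E) \<le> (\<integral>\<^sup>+t\<in>E. ennreal (m powr p) \<partial>\<mu>)"
    unfolding emeasure_weighted_measure_translate[OF \<open>E \<in> sets borel\<close>]
    using p_pos weight_pos
    by (intro nn_integral_mono_AE) (auto intro!: ennreal_leI powr_mono2 simp: less_imp_le split: split_indicator)
  also have "\<dots> = ennreal (m powr p) * emeasure \<mu> E" by (simp add: nn_integral_cmult_indicator)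
  finally have "ennreal (a powr p) * emeasure weighted_measure ((\<lambda>t. s + t) ` E)
      \<le> ennreal (a powr p) * (ennreal (m powr p) * emeasure \<mu> E)"
    by (intro mult_left_mono) auto
  also have "\<dots> = ennreal ((a * m) powr p) * emeasure \<mu> E"
    using a m by (simp add: powr_mult ennreal_mult mult.assoc)
  also have "\<dots> \<le> ennreal (e powr p) * emeasure \<mu> E"
    using am a m p_pos by (intro mult_right_mono ennreal_leI powr_mono2) auto
  finally show ?thesis .
qed

text \<open>Chebyshev's inequality for the p-th power of the translated weight: a bound on an
  integral becomes a pointwise bound outside a set of small measure.\<close>

lemma haar_measure_large_weight_less:
  assumes E: "compact E" and a: "0 < a" and e: "0 < e" and d: "0 < d"
    and less: "ennreal (a powr p) * emeasure weighted_measure ((\<lambda>t. s + t) ` E) < ennreal (d powr p)"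
  shows "emeasure \<mu> {t \<in> E. e < a * \<omega> (s + t)} < ennreal ((d / e) powr p)"
proof -
  have [measurable]: "E \<in> sets borel" using E by (rule borel_compact)
  let ?A = "{t \<in> E. e < a * \<omega> (s + t)}"
  have "ennreal (e powr p) * emeasure \<mu> ?A = (\<integral>\<^sup>+t\<in>?A. ennreal (e powr p) \<partial>\<mu>)"
    by (simp add: nn_integral_cmult_indicator)
  also have "\<dots> \<le> (\<integral>\<^sup>+t. ennreal (a powr p) * (ennreal (\<omega> (s + t) powr p) * indicator E t) \<partial>\<mu>)"
  proof (rule nn_integral_mono)
    fix t
    have "e powr p \<le> a powr p * \<omega> (s + t) powr p" if "e < a * \<omega> (s + t)"
      using that a e p_pos weight_pos[of "s + t"] powr_mono2[of p e "a * \<omega> (s + t)"] by (simp add: powr_mult)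
    then show "ennreal (e powr p) * indicator ?A t
        \<le> ennreal (a powr p) * (ennreal (\<omega> (s + t) powr p) * indicator E t)"
      by (auto split: split_indicator simp flip: ennreal_mult intro!: ennreal_leI)
  qed
  also have "\<dots> = ennreal (a powr p) * emeasure weighted_measure ((\<lambda>t. s + t) ` E)"
    by (simp add: nn_integral_cmult emeasure_weighted_measure_translate)
  also note less
  finally have "emeasure \<mu> ?A < ennreal (d powr p / e powr p)"
    using e by (intro ennreal_less_divide_if_mult_less) auto
  also have "d powr p / e powr p = (d / e) powr p"
    using e d by (simp add: powr_divide)
  finally show ?thesis .
qed

text \<open>The p-th power of the weighted norm; a modular in the sense of modular function spaces,
  unrelated to the modular function of the group.\<close>

definition modular :: "('a \<Rightarrow> complex) \<Rightarrow> ennreal" where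
  "modular f = (\<integral>\<^sup>+t. ennreal (norm (f t) powr p) \<partial>weighted_measure)"

lemma modular_eq:
  assumes [measurable]: "f \<in> borel_measurable borel"
  shows "modular f = (\<integral>\<^sup>+t. ennreal (norm (f t) powr p * \<omega> t powr p) \<partial>\<mu>)"
  unfolding modular_def
  by (subst nn_integral_weighted_measure) (auto simp: mult.commute ennreal_mult)

lemma weighted_norm_less_iff:
  assumes "f \<in> borel_measurable borel" "0 < e"
  shows "weighted_norm \<mu> p \<omega> f < ennreal e \<longleftrightarrow> modular f < ennreal (e powr p)"
  using assms p_pos by (simp add: weighted_norm_def ennreal_powr_inverse_less_iff modular_eq)

lemma weighted_Lp_iff:
  "f \<in> weighted_Lp \<mu> p \<omega> \<longleftrightarrow> f \<in> borel_measurable borel \<and> modular f < \<infinity>"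
proof (cases "f \<in> borel_measurable borel")
  case True
  then show ?thesis
    by (auto simp: weighted_Lp_def weighted_norm_def modular_eq ennreal_powr_def less_top
        cong: measurable_cong_sets)
qed (simp add: weighted_Lp_def cong: measurable_cong_sets)

lemma modular_cong_norm:
  assumes "\<And>t. norm (f t) = norm (g t)"
  shows "modular f = modular g"
  unfolding modular_def using assms by simp

lemma modular_zero[simp]: "modular (\<lambda>t. 0) = 0"
  using p_pos by (simp add: modular_def)

lemma modular_cmult:
  assumes [measurable]: "f \<in> borel_measurable borel"
  shows "modular (\<lambda>t. c * f t) = ennreal (norm c powr p) * modular f"
  unfolding modular_def by (simp add: norm_mult powr_mult ennreal_mult nn_integral_cmult)

lemma modular_add_le:
  assumes [measurable]: "f \<in> borel_measurable borel" "g \<in> borel_measurable borel"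
  shows "modular (\<lambda>t. f t + g t) \<le> ennreal (2 powr p) * (modular f + modular g)"
proof -
  have "modular (\<lambda>t. f t + g t)
      \<le> (\<integral>\<^sup>+t. ennreal (2 powr p) * (ennreal (norm (f t) powr p) + ennreal (norm (g t) powr p)) \<partial>weighted_measure)"
    unfolding modular_def
    by (intro nn_integral_mono) (use norm_add_powr_le[OF p_pos] in \<open>simp flip: ennreal_plus ennreal_mult add: ennreal_leI\<close>)
  also have "\<dots> = ennreal (2 powr p) * (modular f + modular g)"
    by (simp add: nn_integral_cmult nn_integral_add modular_def)
  finally show ?thesis .
qed

lemma modular_diff_triangle:
  assumes [measurable]: "f \<in> borel_measurable borel" "g \<in> borel_measurable borel" "h \<in> borel_measurable borel"
  shows "modular (\<lambda>t. f t - h t) \<le> ennreal (2 powr p) * (modular (\<lambda>t. f t - g t) + modular (\<lambda>t. g t - h t))"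
  using modular_add_le[of "\<lambda>t. f t - g t" "\<lambda>t. g t - h t"] by simp

lemma modular_translate:
  assumes [measurable]: "f \<in> borel_measurable borel"
  shows "modular (\<lambda>t. f (- s + t)) = (\<integral>\<^sup>+t. ennreal (norm (f t) powr p * \<omega> (s + t) powr p) \<partial>\<mu>)"
proof -
  have "modular (\<lambda>t. f (- s + t)) = (\<integral>\<^sup>+t. ennreal (norm (f (- s + t)) powr p * \<omega> t powr p) \<partial>\<mu>)"
    by (rule modular_eq) measurable
  also have "\<dots> = (\<integral>\<^sup>+t. ennreal (norm (f (- s + (s + t))) powr p * \<omega> (s + t) powr p) \<partial>\<mu>)"
    by (rule nn_integral_translate[symmetric]) measurable
  finally show ?thesis by (simp add: add.assoc[symmetric])
qed

lemma modular_le_bound: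
  assumes [measurable]: "A \<in> sets borel"
    and "\<And>t. t \<in> A \<Longrightarrow> norm (f t) \<le> C" "\<And>t. t \<notin> A \<Longrightarrow> f t = 0"
  shows "modular f \<le> ennreal (C powr p) * emeasure weighted_measure A"
proof -
  have "modular f \<le> (\<integral>\<^sup>+t\<in>A. ennreal (C powr p) \<partial>weighted_measure)"
    unfolding modular_def using assms p_pos
    by (intro nn_integral_mono) (auto intro!: ennreal_leI powr_mono2 split: split_indicator)
  then show ?thesis by (simp add: nn_integral_cmult_indicator)
qed

lemma modular_ge_bound:
  assumes [measurable]: "A \<in> sets borel"
    and "\<And>t. t \<in> A \<Longrightarrow> C \<le> norm (f t)" "0 \<le> C"
  shows "ennreal (C powr p) * emeasure weighted_measure A \<le> modular f"
proof -
  have "(\<integral>\<^sup>+t\<in>A. ennreal (C powr p) \<partial>weighted_measure) \<le> modular f"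
    unfolding modular_def using assms p_pos
    by (intro nn_integral_mono) (auto intro!: ennreal_leI powr_mono2 split: split_indicator)
  then show ?thesis by (simp add: nn_integral_cmult_indicator)
qed

text \<open>On this class the modular is finite by local integrability, and translation by any group
  element preserves it. This matters for \<open>- s\<close> with \<open>s\<close> in
  \<open>S\<close>, whose translation need not map the weighted space into itself.\<close>

definition compactly_bounded :: "('a \<Rightarrow> complex) \<Rightarrow> bool" where
  "compactly_bounded f \<longleftrightarrow> f \<in> borel_measurable borel \<and> (\<exists>C\<ge>0. \<forall>t. norm (f t) \<le> C) \<and>
     (\<exists>K. compact K \<and> (\<forall>t. t \<notin> K \<longrightarrow> f t = 0))"

lemma compactly_boundedI:
  assumes "f \<in> borel_measurable borel" "\<And>t. norm (f t) \<le> C" "compact K" "\<And>t. t \<notin> K \<Longrightarrow> f t = 0"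
  shows "compactly_bounded f"
proof -
  have "norm (f t) \<le> max 0 C" for t using assms(2)[of t] by simp
  then show ?thesis using assms unfolding compactly_bounded_def by (meson max.cobounded1)
qed

lemma compactly_boundedE:
  assumes "compactly_bounded f"
  obtains C K where "0 \<le> C" "\<And>t. norm (f t) \<le> C" "compact K" "\<And>t. t \<notin> K \<Longrightarrow> f t = 0"
  using assms unfolding compactly_bounded_def by blast

lemma compactly_bounded_measurable: "compactly_bounded f \<Longrightarrow> f \<in> borel_measurable borel"
  by (simp add: compactly_bounded_def)

lemma compactly_bounded_modular: "compactly_bounded f \<Longrightarrow> modular f < \<infinity>"
proof (erule compactly_boundedE)
  fix C K assume K: "\<And>t. norm (f t) \<le> C" "compact K" "\<And>t. t \<notin> K \<Longrightarrow> f t = 0"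
  then have "modular f \<le> ennreal (C powr p) * emeasure weighted_measure K"
    by (intro modular_le_bound borel_compact) auto
  also have "\<dots> < \<infinity>"
    using emeasure_weighted_measure_compact[OF K(2)] by (simp add: ennreal_mult_less_top)
  finally show ?thesis .
qed

lemma compactly_bounded_zero: "compactly_bounded (\<lambda>t. 0)"
  by (rule compactly_boundedI[of _ 0 "{}"]) auto

lemma compactly_bounded_add:
  assumes f: "compactly_bounded f" and g: "compactly_bounded g"
  shows "compactly_bounded (\<lambda>t. f t + g t)"
proof -
  obtain C K where K: "\<And>t. norm (f t) \<le> C" "compact K" "\<And>t. t \<notin> K \<Longrightarrow> f t = 0"
    using compactly_boundedE[OF f] by metis
  obtain D L where L: "\<And>t. norm (g t) \<le> D" "compact L" "\<And>t. t \<notin> L \<Longrightarrow> g t = 0"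
    using compactly_boundedE[OF g] by metis
  have "norm (f t + g t) \<le> C + D" for t
    using K(1)[of t] L(1)[of t] norm_triangle_ineq[of "f t" "g t"] by linarith
  then show ?thesis
    using f g K L by (intro compactly_boundedI[of _ "C + D" "K \<union> L"])
      (auto intro: borel_measurable_add compactly_bounded_measurable)
qed

lemma compactly_bounded_cmult_translate:
  assumes f: "compactly_bounded f"
  shows "compactly_bounded (\<lambda>t. c * f (- s + t))"
proof -
  obtain C K where K: "\<And>t. norm (f t) \<le> C" "compact K" "\<And>t. t \<notin> K \<Longrightarrow> f t = 0"
    using compactly_boundedE[OF f] by metis
  have [measurable]: "f \<in> borel_measurable borel" using f by (rule compactly_bounded_measurable)
  have "- s + t \<notin> K" if "t \<notin> (\<lambda>t. s + t) ` K" for t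
  proof
    assume "- s + t \<in> K"
    then have "s + (- s + t) \<in> (\<lambda>t. s + t) ` K" by (rule imageI)
    then show False using that by (simp add: add.assoc[symmetric])
  qed
  then show ?thesis
    using K by (intro compactly_boundedI[of _ "norm c * C" "(\<lambda>t. s + t) ` K"])
      (auto simp: norm_mult intro!: mult_left_mono compact_translate)
qed

lemma compactly_bounded_indicator:
  assumes f: "compactly_bounded f" and [measurable]: "A \<in> sets borel"
  shows "compactly_bounded (\<lambda>t. f t * indicator A t)"
proof -
  obtain C K where K: "0 \<le> C" "\<And>t. norm (f t) \<le> C" "compact K" "\<And>t. t \<notin> K \<Longrightarrow> f t = 0"
    using compactly_boundedE[OF f] by metis
  have [measurable]: "f \<in> borel_measurable borel" using f by (rule compactly_bounded_measurable)
  show ?thesis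
    using K by (intro compactly_boundedI[of _ C K]) (auto split: split_indicator)
qed

text \<open>Substitution puts the translation on the weight, where admissibility bounds
  \<open>\<omega> (s + t)\<close> by a multiple \<open>m\<close> of \<open>\<omega> t\<close> almost
  everywhere; \<open>L\<close> is \<open>m powr p\<close>.\<close>

lemma modular_translate_bound:
  assumes "admissible_weight \<mu> S \<omega>" "s \<in> S"
  obtains L where "0 \<le> L"
    "\<And>f (c :: complex). f \<in> borel_measurable borel \<Longrightarrow>
       modular (\<lambda>t. c * f (- s + t)) \<le> ennreal (norm c powr p * L) * modular f"
proof -
  let ?q = "\<lambda>t. \<omega> (s + t) / \<omega> t"
  have "ess_sup_on \<mu> UNIV ?q < \<infinity>" using assms by (simp add: admissible_weight_def)
  then obtain m where m: "0 \<le> m" "ess_sup_on \<mu> UNIV ?q = ennreal m"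
    by (cases "ess_sup_on \<mu> UNIV ?q") auto
  have "AE t in restrict_space \<mu> UNIV. ennreal (?q t) \<le> ennreal m"
    using esssup_AE[where M = "restrict_space \<mu> UNIV" and f = "\<lambda>t. ennreal (?q t)"] m by (simp add: ess_sup_on_def)
  then have "AE t in \<mu>. ?q t \<le> m"
    using m by (subst (asm) AE_restrict_space_iff) auto
  then have ae: "AE t in \<mu>. \<omega> (s + t) powr p \<le> m powr p * \<omega> t powr p"
  proof eventually_elim
    case (elim t)
    then have "\<omega> (s + t) \<le> m * \<omega> t" using weight_pos[of t] by (simp add: field_simps)
    then show ?case
      using p_pos weight_pos[of "s + t"] weight_pos[of t] m powr_mono2[of p "\<omega> (s + t)" "m * \<omega> t"]
      by (simp add: powr_mult)
  qed
  show ?thesis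
  proof
    show "0 \<le> m powr p" by simp
    fix f :: "'a \<Rightarrow> complex" and c :: complex assume [measurable]: "f \<in> borel_measurable borel"
    have "modular (\<lambda>t. f (- s + t)) = (\<integral>\<^sup>+t. ennreal (norm (f t) powr p * \<omega> (s + t) powr p) \<partial>\<mu>)"
      by (rule modular_translate) measurable
    also have "\<dots> \<le> (\<integral>\<^sup>+t. ennreal (m powr p) * ennreal (norm (f t) powr p * \<omega> t powr p) \<partial>\<mu>)"
      using ae
    proof (intro nn_integral_mono_AE, eventually_elim)
      case (elim t)
      then have "norm (f t) powr p * \<omega> (s + t) powr p \<le> norm (f t) powr p * (m powr p * \<omega> t powr p)"
        by (intro mult_left_mono) auto
      then show ?case by (simp add: mult_ac ennreal_leI flip: ennreal_mult)
    qed
    also have "\<dots> = ennreal (m powr p) * modular f"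
      by (simp add: nn_integral_cmult modular_eq)
    finally have "ennreal (norm c powr p) * modular (\<lambda>t. f (- s + t))
        \<le> ennreal (norm c powr p) * (ennreal (m powr p) * modular f)"
      by (intro mult_left_mono) auto
    then show "modular (\<lambda>t. c * f (- s + t)) \<le> ennreal (norm c powr p * m powr p) * modular f"
      by (simp add: modular_cmult[of "\<lambda>t. f (- s + t)"] ennreal_mult mult.assoc)
  qed
qed

subsection \<open>Small translates\<close>

text \<open>Written with \<open>\<epsilon> powr p\<close> so that it is literally the p-norm
  condition raised to the p-th power.\<close>

definition small_translates :: "'a set \<Rightarrow> complex set \<Rightarrow> bool" where
  "small_translates S \<Gamma> \<longleftrightarrow> (\<forall>F. compact F \<longrightarrow> (\<forall>\<epsilon>>0. \<exists>s\<in>S. \<exists>c\<in>\<Gamma> - {0}. \<exists>E. compact E \<and> E \<subseteq> F \<and>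
     emeasure \<mu> (F - E) < ennreal \<epsilon> \<and>
     ennreal (norm c powr p) * emeasure weighted_measure ((\<lambda>t. s + t) ` E) < ennreal (\<epsilon> powr p) \<and>
     ennreal ((1 / norm c) powr p) * emeasure weighted_measure ((\<lambda>t. - s + t) ` E) < ennreal (\<epsilon> powr p)))"

section \<open>Integrals versus essential suprema\<close>

lemma small_translates_iff_p_norm:
  "small_translates S \<Gamma> \<longleftrightarrow> (\<forall>F. compact F \<longrightarrow> (\<forall>\<epsilon>>0. \<exists>s\<in>S. \<exists>c\<in>\<Gamma> - {0}. \<exists>E. compact E \<and> E \<subseteq> F \<and>
     emeasure \<mu> (F - E) < ennreal \<epsilon> \<and>
     ennreal (norm c) * p_norm_on \<mu> p ((\<lambda>t. s + t) ` E) \<omega> < ennreal \<epsilon> \<and>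
     ennreal (1 / norm c) * p_norm_on \<mu> p ((\<lambda>t. - s + t) ` E) \<omega> < ennreal \<epsilon>))"
  unfolding small_translates_def
  by (intro all_cong bex_cong refl ex_cong conj_cong) (simp_all add: p_norm_on_less_iff)

lemma small_translates_if_ess_sup:
  assumes H: "\<forall>F. compact F \<longrightarrow> (\<forall>\<epsilon>>0. \<exists>s\<in>S. \<exists>c\<in>\<Gamma> - {0}. \<exists>E. compact E \<and> E \<subseteq> F \<and>
          emeasure \<mu> (F - E) < ennreal \<epsilon> \<and>
          ennreal (norm c) * ess_sup_on \<mu> E (\<lambda>t. \<omega> (s + t)) < ennreal \<epsilon> \<and>
          ennreal (1 / norm c) * ess_sup_on \<mu> E (\<lambda>t. \<omega> (- s + t)) < ennreal \<epsilon>)"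
  shows "small_translates S \<Gamma>"
  unfolding small_translates_def
proof (intro allI impI)
  fix F :: "'a set" and \<epsilon> :: real assume F: "compact F" and \<epsilon>: "0 < \<epsilon>"
  obtain m where m: "0 \<le> m" "emeasure \<mu> F = ennreal m"
    using emeasure_compact_finite[OF F] by (cases "emeasure \<mu> F") auto
  \<comment> \<open>Chosen so that \<open>d powr p * (m + 1) = \<epsilon> powr p\<close>, which
    leaves strict room for \<open>d powr p * m\<close>. Using \<open>m + 1\<close> instead of
    \<open>m\<close> also gives \<open>d \<le> \<epsilon>\<close> and avoids division by 0.\<close>
  define d where "d = \<epsilon> / (m + 1) powr (1 / p)"
  have d: "0 < d" using \<epsilon> m by (simp add: d_def)
  have "1 \<le> (m + 1) powr (1 / p)" using m p_pos by (intro ge_one_powr_ge_zero) auto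
  then have "d \<le> \<epsilon>" using \<epsilon> by (simp add: d_def divide_le_eq)
  have "d powr p = \<epsilon> powr p / (m + 1)"
    using \<epsilon> m p_pos by (simp add: d_def powr_divide powr_powr)
  then have dm: "d powr p * m < \<epsilon> powr p"
    using \<epsilon> m by (simp add: divide_less_eq)
  obtain s c E where *: "s \<in> S" "c \<in> \<Gamma> - {0}" "compact E" "E \<subseteq> F" "emeasure \<mu> (F - E) < ennreal d"
    "ennreal (norm c) * ess_sup_on \<mu> E (\<lambda>t. \<omega> (s + t)) < ennreal d"
    "ennreal (1 / norm c) * ess_sup_on \<mu> E (\<lambda>t. \<omega> (- s + t)) < ennreal d"
    using H F d by metis
  have "ennreal (d powr p) * emeasure \<mu> E \<le> ennreal (d powr p) * emeasure \<mu> F"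
    using *(4) F by (intro mult_left_mono emeasure_mono) (auto simp: borel_compact)
  also have "\<dots> < ennreal (\<epsilon> powr p)"
    using dm m by (simp add: ennreal_less_iff flip: ennreal_mult)
  finally have **: "ennreal (d powr p) * emeasure \<mu> E < ennreal (\<epsilon> powr p)" .
  have "ennreal (norm c powr p) * emeasure weighted_measure ((\<lambda>t. s + t) ` E) < ennreal (\<epsilon> powr p)"
    using * d by (intro le_less_trans[OF weighted_measure_le_ess_sup_on **]) auto
  moreover have "ennreal ((1 / norm c) powr p) * emeasure weighted_measure ((\<lambda>t. - s + t) ` E) < ennreal (\<epsilon> powr p)"
    using * d by (intro le_less_trans[OF weighted_measure_le_ess_sup_on **]) auto
  moreover have "emeasure \<mu> (F - E) < ennreal \<epsilon>"
    using *(5) \<open>d \<le> \<epsilon>\<close> by (rule less_le_trans[OF _ ennreal_leI])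
  ultimately show "\<exists>s\<in>S. \<exists>c\<in>\<Gamma> - {0}. \<exists>E. compact E \<and> E \<subseteq> F \<and> emeasure \<mu> (F - E) < ennreal \<epsilon> \<and>
     ennreal (norm c powr p) * emeasure weighted_measure ((\<lambda>t. s + t) ` E) < ennreal (\<epsilon> powr p) \<and>
     ennreal ((1 / norm c) powr p) * emeasure weighted_measure ((\<lambda>t. - s + t) ` E) < ennreal (\<epsilon> powr p)"
    using *(1-4) by blast
qed

lemma ess_sup_if_small_translates:
  assumes H: "small_translates S \<Gamma>" and F: "compact F" and \<epsilon>: "0 < \<epsilon>"
  shows "\<exists>s\<in>S. \<exists>c\<in>\<Gamma> - {0}. \<exists>E. compact E \<and> E \<subseteq> F \<and>
          emeasure \<mu> (F - E) < ennreal \<epsilon> \<and>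
          ennreal (norm c) * ess_sup_on \<mu> E (\<lambda>t. \<omega> (s + t)) < ennreal \<epsilon> \<and>
          ennreal (1 / norm c) * ess_sup_on \<mu> E (\<lambda>t. \<omega> (- s + t)) < ennreal \<epsilon>"
proof -
  have [measurable]: "F \<in> sets borel" using F by (rule borel_compact)
  \<comment> \<open>Four exceptional sets get \<open>\<epsilon> / 4\<close> each. The first entry of
    the minimum serves \<open>F - E\<close>, the second makes the Chebyshev bound
    \<open>(d / (\<epsilon> / 2)) powr p\<close> at most \<open>\<epsilon> / 4\<close>.\<close>
  define d where "d = min (\<epsilon> / 4) (\<epsilon> / 2 * (\<epsilon> / 4) powr (1 / p))"
  have d: "0 < d" "d \<le> \<epsilon> / 4" using \<epsilon> by (auto simp: d_def)
  have "d / (\<epsilon> / 2) \<le> (\<epsilon> / 4) powr (1 / p)"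
    using \<epsilon> by (simp add: d_def divide_le_eq min_le_iff_disj mult.commute)
  then have "(d / (\<epsilon> / 2)) powr p \<le> ((\<epsilon> / 4) powr (1 / p)) powr p"
    using d \<epsilon> p_pos by (intro powr_mono2) auto
  then have dp: "(d / (\<epsilon> / 2)) powr p \<le> \<epsilon> / 4"
    using \<epsilon> p_pos by (simp add: powr_powr)
  obtain s c E where *: "s \<in> S" "c \<in> \<Gamma> - {0}" "compact E" "E \<subseteq> F" "emeasure \<mu> (F - E) < ennreal d"
    "ennreal (norm c powr p) * emeasure weighted_measure ((\<lambda>t. s + t) ` E) < ennreal (d powr p)"
    "ennreal ((1 / norm c) powr p) * emeasure weighted_measure ((\<lambda>t. - s + t) ` E) < ennreal (d powr p)"
    using H F d unfolding small_translates_def by metis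
  have [measurable]: "E \<in> sets borel" using *(3) by (rule borel_compact)
  \<comment> \<open>The threshold is \<open>\<epsilon> / 2\<close> because the complement of these
    sets yields only a weak inequality for the essential supremum, while a strict one is
    wanted.\<close>
  define A where "A = {t \<in> E. \<epsilon> / 2 < norm c * \<omega> (s + t)}"
  define B where "B = {t \<in> E. \<epsilon> / 2 < 1 / norm c * \<omega> (- s + t)}"
  have [measurable]: "A \<in> sets borel" "B \<in> sets borel" unfolding A_def B_def by measurable
  have A: "emeasure \<mu> A < ennreal (\<epsilon> / 4)"
    unfolding A_def using * d \<epsilon> dp
    by (intro less_le_trans[OF haar_measure_large_weight_less ennreal_leI]) auto
  have B: "emeasure \<mu> B < ennreal (\<epsilon> / 4)"
    unfolding B_def using * d \<epsilon> dp
    by (intro less_le_trans[OF haar_measure_large_weight_less ennreal_leI]) auto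
  \<comment> \<open>The set left after removing \<open>A\<close> and \<open>B\<close> is only Borel,
    hence one more loss of \<open>\<epsilon> / 4\<close> to make it compact.\<close>
  obtain E' where E': "compact E'" "E' \<subseteq> E - (A \<union> B)" "emeasure \<mu> (E - (A \<union> B) - E') < ennreal (\<epsilon> / 4)"
    using \<epsilon> by (rule_tac compact_inner_approximation[OF *(3), of "E - (A \<union> B)" "\<epsilon> / 4"]) auto
  have [measurable]: "E' \<in> sets borel" using E'(1) by (rule borel_compact)
  have "emeasure \<mu> (F - E') \<le> emeasure \<mu> ((F - E) \<union> A \<union> B \<union> (E - (A \<union> B) - E'))"
    using *(4) by (intro emeasure_mono) auto
  also have "\<dots> \<le> emeasure \<mu> (F - E) + emeasure \<mu> A + emeasure \<mu> B + emeasure \<mu> (E - (A \<union> B) - E')"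
    by (intro emeasure_subadditive[THEN order_trans] add_right_mono) auto
  also have "\<dots> < ennreal (\<epsilon> / 4) + ennreal (\<epsilon> / 4) + ennreal (\<epsilon> / 4) + ennreal (\<epsilon> / 4)"
    using less_le_trans[OF *(5) ennreal_leI[OF d(2)]] A B E'(3)
    by (intro add_strict_mono)
  also have "\<dots> = ennreal \<epsilon>" using \<epsilon> by (simp flip: ennreal_plus)
  finally have "emeasure \<mu> (F - E') < ennreal \<epsilon>" .
  moreover have "ennreal (norm c) * ess_sup_on \<mu> E' (\<lambda>t. \<omega> (s + t)) < ennreal \<epsilon>"
  proof -
    have "ennreal (norm c) * ess_sup_on \<mu> E' (\<lambda>t. \<omega> (s + t)) \<le> ennreal (\<epsilon> / 2)"
      using E' *(2) by (intro ess_sup_on_le) (auto simp: A_def not_less)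
    also have "\<dots> < ennreal \<epsilon>" using \<epsilon> by (simp add: ennreal_lessI)
    finally show ?thesis .
  qed
  moreover have "ennreal (1 / norm c) * ess_sup_on \<mu> E' (\<lambda>t. \<omega> (- s + t)) < ennreal \<epsilon>"
  proof -
    have "ennreal (1 / norm c) * ess_sup_on \<mu> E' (\<lambda>t. \<omega> (- s + t)) \<le> ennreal (\<epsilon> / 2)"
    proof (rule ess_sup_on_le[OF E'(1)])
      fix t assume "t \<in> E'"
      then have "t \<in> E" "t \<notin> B" using E'(2) by auto
      then show "1 / norm c * \<omega> (- s + t) \<le> \<epsilon> / 2" by (auto simp: B_def not_less)
    qed (use *(2) in auto)
    also have "\<dots> < ennreal \<epsilon>" using \<epsilon> by (simp add: ennreal_lessI)
    finally show ?thesis .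
  qed
  moreover have "E' \<subseteq> F" using E'(2) *(4) by auto
  ultimately show ?thesis using *(1,2) E'(1) by blast
qed

text \<open>
  The two values 1 and 3 of the target on \<open>B\<close> force \<open>s + B\<close> and \<open>B\<close> to be almost disjoint: \<open>f\<close> is
  nearly \<open>{0, 1}\<close>-valued, so a multiple of a translate of \<open>f\<close> can take only one of the two values
  on a substantial set, unless its nonzero values are taken outside \<open>B\<close>.
\<close>

lemma two_valued_target:
  assumes A: "compact A" and B: "compact B" and AB: "A \<subseteq> B"
    and pos: "0 < emeasure \<mu> A" "0 < emeasure \<mu> (B - A)" and \<epsilon>: "0 < \<epsilon>"
  defines "h \<equiv> (indicator B :: 'a \<Rightarrow> complex)"
  defines "g \<equiv> (\<lambda>t. if t \<in> A then 1 else if t \<in> B then 3 else 0 :: complex)"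
  shows "\<exists>d>0. \<forall>f s c. f \<in> borel_measurable borel \<longrightarrow> c \<noteq> 0 \<longrightarrow> modular (\<lambda>t. h t - f t) < ennreal d \<longrightarrow>
    modular (\<lambda>t. g t - c * f (- s + t)) < ennreal d \<longrightarrow>
    (\<exists>E. compact E \<and> E \<subseteq> B \<and> emeasure \<mu> (B - E) < ennreal \<epsilon> \<and>
     ennreal (norm c powr p) * emeasure weighted_measure ((\<lambda>t. s + t) ` E) < ennreal (\<epsilon> powr p) \<and>
     ennreal ((1 / norm c) powr p) * emeasure weighted_measure ((\<lambda>t. - s + t) ` E) < ennreal (\<epsilon> powr p))"
proof -
  have [measurable]: "A \<in> sets borel" "B \<in> sets borel" using A B by (auto intro: borel_compact)
  have [measurable]: "h \<in> borel_measurable borel" "g \<in> borel_measurable borel"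
    unfolding h_def g_def by measurable
  obtain a where a: "0 < a" "ennreal a \<le> emeasure \<mu> A" using pos(1) by (rule pos_ennreal_ge_pos_real)
  obtain b where b: "0 < b" "ennreal b \<le> emeasure \<mu> (B - A)" using pos(2) by (rule pos_ennreal_ge_pos_real)
  \<comment> \<open>The loss at the end is \<open>4 * e + 4 * e + e + e + e\<close>, that is
    \<open>11 * e\<close>. The quarters of \<open>a\<close> and \<open>b\<close> ensure that neither
    \<open>A\<close> nor \<open>B - A\<close> can be absorbed by the exceptional sets.\<close>
  define e where "e = min (\<epsilon> / 11) (min (a / 4) (b / 4))"
  have e: "0 < e" "11 * e \<le> \<epsilon>" "4 * e \<le> a" "4 * e \<le> b" using a b \<epsilon> by (auto simp: e_def)
  have eA: "ennreal (4 * e) \<le> emeasure \<mu> A" "ennreal (4 * e) \<le> emeasure \<mu> (B - A)"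
    using order_trans[OF ennreal_leI[OF e(3)] a(2)] order_trans[OF ennreal_leI[OF e(4)] b(2)] by auto
  \<comment> \<open>If \<open>t\<close> and \<open>- s + t\<close> lie in \<open>B\<close>, then
    \<open>- s + u = (- s + t) + - t + u\<close> lies in \<open>K\<close> for every \<open>u\<close>
    in \<open>B\<close>. Thus a single compact set, independent of \<open>s\<close>, contains
    \<open>- s + B\<close> whenever \<open>s\<close> makes \<open>B\<close> meet its
    translate.\<close>
  define K where "K = B \<union> (\<lambda>(x, y, z). x + - y + z) ` (B \<times> B \<times> B)"
  have "compact ((\<lambda>(x, y, z). x + - y + z) ` (B \<times> B \<times> B))"
    unfolding case_prod_beta by (intro compact_continuous_image continuous_intros compact_Times B)
  then have K: "compact K" unfolding K_def using B by auto
  then have [measurable]: "K \<in> sets borel" by (rule borel_compact)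
  obtain d where d: "0 < d" "\<And>X. X \<in> sets borel \<Longrightarrow> X \<subseteq> K \<Longrightarrow>
      emeasure weighted_measure X < ennreal d \<Longrightarrow> emeasure \<mu> X < ennreal e"
    using haar_measure_small[OF K e(1)] by auto
  \<comment> \<open>The first entry makes the sets where an error reaches 1/10 small for \<nu>,
    hence for \<mu>; the second absorbs the factor 9/10 lost in the final lower bounds.\<close>
  define d' where "d' = min ((1/10) powr p * d) ((9/10 * \<epsilon>) powr p)"
  have d': "0 < d'" using d \<epsilon> by (simp add: d'_def)
  have small: "emeasure \<mu> {t \<in> X. 1/10 \<le> norm (k t)} < ennreal e"
    if "modular k < ennreal d'" "X \<in> sets borel" "X \<subseteq> K" and [measurable]: "k \<in> borel_measurable borel" for k X
  proof (rule d(2))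
    have [measurable]: "X \<in> sets borel" by fact
    show *: "{t \<in> X. 1/10 \<le> norm (k t)} \<in> sets borel" by measurable
    have "ennreal ((1/10) powr p) * emeasure weighted_measure {t \<in> X. 1/10 \<le> norm (k t)} \<le> modular k"
      by (intro modular_ge_bound *) auto
    also have "\<dots> < ennreal d'" by fact
    also have "\<dots> \<le> ennreal ((1/10) powr p * d)" by (intro ennreal_leI) (simp add: d'_def)
    finally show "emeasure weighted_measure {t \<in> X. 1/10 \<le> norm (k t)} < ennreal d"
      using ennreal_less_divide_if_mult_less[of "(1/10) powr p"] by fastforce
  qed (use that in auto)
  show ?thesis
  proof (intro exI[of _ d'] conjI allI impI)
    show "0 < d'" by (rule d')
    fix f :: "'a \<Rightarrow> complex" and s c
    assume [measurable]: "f \<in> borel_measurable borel" and c: "c \<noteq> 0"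
      and mf: "modular (\<lambda>t. h t - f t) < ennreal d'"
      and mg: "modular (\<lambda>t. g t - c * f (- s + t)) < ennreal d'"
    define P where "P = {t \<in> K. 1/10 \<le> norm (h t - f t)}"
    define Q where "Q = {t \<in> B. 1/10 \<le> norm (g t - c * f (- s + t))}"
    have [measurable]: "P \<in> sets borel" "Q \<in> sets borel" unfolding P_def Q_def by measurable
    have P: "emeasure \<mu> P < ennreal e" unfolding P_def by (rule small[OF mf]) auto
    have Q: "emeasure \<mu> Q < ennreal e" unfolding Q_def by (rule small[OF mg]) (auto simp: K_def)
    \<comment> \<open>The points \<open>t\<close> for which \<open>f\<close> is badly approximated
      at \<open>- s + t\<close>; left invariance keeps the measure of this set below
      \<open>e\<close>.\<close>
    define P' where "P' = (\<lambda>t. s + t) ` P"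
    have [measurable]: "P' \<in> sets borel" unfolding P'_def by measurable
    have P': "emeasure \<mu> P' < ennreal e" using P by (simp add: P'_def emeasure_translate)
    have mem_translate: "t \<in> (\<lambda>t. s + t) ` X \<longleftrightarrow> - s + t \<in> X"
      "t \<in> (\<lambda>t. - s + t) ` X \<longleftrightarrow> s + t \<in> X" for t s :: 'a and X
      using vimage_add_left[of "- s" X] vimage_add_left[of s X] by auto
    \<comment> \<open>\<open>Q\<close> and \<open>P'\<close> together have measure below
      \<open>2 * e\<close>, so a set of measure at least \<open>4 * e\<close> contains a point where
      both approximations hold.\<close>
    have avoid: "\<exists>t\<in>X. t \<notin> Q \<and> t \<notin> P'" if X: "ennreal (4 * e) \<le> emeasure \<mu> X" for X
    proof (rule ccontr)
      assume "\<not> ?thesis"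
      then have "emeasure \<mu> X \<le> emeasure \<mu> (Q \<union> P')" by (intro emeasure_mono) auto
      also have "\<dots> \<le> emeasure \<mu> Q + emeasure \<mu> P'" by (intro emeasure_subadditive) auto
      also have "\<dots> < ennreal e + ennreal e" using Q P' by (rule add_strict_mono)
      also have "\<dots> \<le> ennreal (4 * e)" using e by (simp flip: ennreal_plus add: ennreal_leI)
      finally show False using X by simp
    qed
    have overlap: "emeasure \<mu> (B \<inter> (\<lambda>t. s + t) ` B) < ennreal (4 * e)"
    proof (rule ccontr)
      assume "\<not> ?thesis"
      then obtain t where t: "t \<in> B" "- s + t \<in> B" "t \<notin> Q" "t \<notin> P'"
        using avoid[of "B \<inter> (\<lambda>t. s + t) ` B"] by (auto simp: mem_translate not_less)
      obtain t1 where t1: "t1 \<in> A" "t1 \<notin> Q" "t1 \<notin> P'" using avoid[OF eA(1)] by blast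
      obtain t2 where t2: "t2 \<in> B" "t2 \<notin> A" "t2 \<notin> Q" "t2 \<notin> P'" using avoid[OF eA(2)] by blast
      have inK: "- s + u \<in> K" if "u \<in> B" for u
      proof -
        have "- s + u = (- s + t) + - t + u" by (simp add: add.assoc)
        then show ?thesis using that t(1,2) by (force simp: K_def)
      qed
      have Qd: "norm (g u - c * f (- s + u)) < 1/10" if "u \<in> B" "u \<notin> Q" for u
        using that by (auto simp: Q_def)
      have Pd: "norm (h (- s + u) - f (- s + u)) < 1/10" if "u \<in> B" "u \<notin> P'" for u
        using that inK[of u] by (auto simp: P'_def mem_translate P_def)
      let ?f = "\<lambda>u. norm (f (- s + u))"
      have f01: "?f u < 1/10 \<or> 9/10 < ?f u \<and> ?f u < 11/10" if "u \<in> B" "u \<notin> P'" for u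
      proof -
        have "norm (h (- s + u)) = 0 \<or> norm (h (- s + u)) = 1" by (auto simp: h_def split: split_indicator)
        then show ?thesis
          using Pd[OF that] norm_triangle_ineq3[of "h (- s + u)" "f (- s + u)"] by (auto simp: abs_less_iff)
      qed
      have ft: "9/10 < ?f t"
        using Pd[OF t(1,4)] t(2) norm_triangle_ineq3[of "h (- s + t)" "f (- s + t)"] by (auto simp: h_def)
      have g: "\<bar>norm (g u) - norm c * ?f u\<bar> < 1/10" if "u \<in> B" "u \<notin> Q" for u
        using Qd[OF that] norm_triangle_ineq3[of "g u" "c * f (- s + u)"] by (simp add: norm_mult)
      \<comment> \<open>At the overlap point \<open>t\<close> the modulus of
        \<open>f (- s + t)\<close> exceeds 9/10, while its product with \<open>norm c\<close> is
        below 3 + 1/10.\<close>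
      have c_le: "norm c < 4"
      proof -
        have "norm (g t) \<le> 3" by (simp add: g_def)
        then have "norm c * ?f t < 31/10" using g[OF t(1,3)] by linarith
        moreover have "norm c * (9/10) \<le> norm c * ?f t" using ft by (intro mult_left_mono) auto
        ultimately show ?thesis by linarith
      qed
      \<comment> \<open>A value below 1/10 would give \<open>norm c * ?f u\<close> at most 4/10, too
        far from \<open>g u\<close>, whose modulus is at least 1.\<close>
      have large: "9/10 < ?f u \<and> ?f u < 11/10" if "u \<in> B" "u \<notin> Q" "u \<notin> P'" for u
      proof (rule ccontr)
        assume "\<not> ?thesis"
        then have "?f u < 1/10" using f01[OF that(1,3)] by blast
        then have "norm c * ?f u \<le> 4 * (1/10)" using c_le by (intro mult_mono) auto
        moreover have "1 \<le> norm (g u)" using that(1) by (simp add: g_def)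
        ultimately show False using g[OF that(1,2)] by linarith
      qed
      have t1B: "t1 \<in> B" using t1(1) AB by blast
      \<comment> \<open>The point \<open>t1\<close> forces \<open>norm c\<close> below 11/9 and
        \<open>t2\<close> forces it above 29/11, which is larger. This is where the ratio 3 of the
        two target values exceeds the spread of \<open>?f\<close> and the errors.\<close>
      have "norm c * (9/10) \<le> norm c * ?f t1" "norm c * ?f t2 \<le> norm c * (11/10)"
        using large[OF t1B t1(2,3)] large[OF t2(1,3,4)] by (intro mult_left_mono; simp)+
      moreover have "norm (g t1) = 1" "norm (g t2) = 3" using t1 t2 by (auto simp: g_def)
      ultimately show False using g[OF t1B t1(2)] g[OF t2(1,3)] by linarith
    qed
    have overlap': "emeasure \<mu> (B \<inter> (\<lambda>t. - s + t) ` B) < ennreal (4 * e)"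
    proof -
      have "(\<lambda>t. s + t) ` (B \<inter> (\<lambda>t. - s + t) ` B) = B \<inter> (\<lambda>t. s + t) ` B"
        by (auto simp: mem_translate add.assoc[symmetric])
      then show ?thesis using overlap emeasure_translate[of "B \<inter> (\<lambda>t. - s + t) ` B" s] by simp
    qed
    \<comment> \<open>On \<open>G\<close> the function \<open>f\<close> is close to 1 and its scaled
      translate is close to \<open>g\<close>, while both translates of a point of \<open>G\<close>
      leave \<open>B\<close>, the set off which \<open>h\<close> and \<open>g\<close>
      vanish.\<close>
    define G where "G = B - ((\<lambda>t. s + t) ` B \<union> (\<lambda>t. - s + t) ` B \<union> P \<union> Q)"
    have [measurable]: "G \<in> sets borel" unfolding G_def by measurable
    have "G \<subseteq> B" by (auto simp: G_def)
    obtain E where E: "compact E" "E \<subseteq> G" "emeasure \<mu> (G - E) < ennreal e"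
      by (rule compact_inner_approximation[OF B \<open>G \<in> sets borel\<close> \<open>G \<subseteq> B\<close> e(1)])
    have [measurable]: "E \<in> sets borel" using E(1) by (rule borel_compact)
    have E_B: "t \<in> B" and E_trans: "- s + t \<notin> B" "s + t \<notin> B"
      and E_f: "9/10 < norm (f t)" and E_cf: "9/10 < norm (c * f (- s + t))" if "t \<in> E" for t
    proof -
      have t: "t \<in> B" "t \<notin> P" "t \<notin> Q" "- s + t \<notin> B" "s + t \<notin> B"
        using that E(2) by (auto simp: G_def mem_translate)
      then show "t \<in> B" "- s + t \<notin> B" "s + t \<notin> B" by auto
      have "norm (h t - f t) < 1/10" using t by (auto simp: P_def K_def)
      then show "9/10 < norm (f t)"
        using t norm_triangle_ineq3[of "h t" "f t"] by (auto simp: h_def)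
      have "norm (g t - c * f (- s + t)) < 1/10" using t by (auto simp: Q_def)
      moreover have "1 \<le> norm (g t)" using t by (simp add: g_def)
      ultimately show "9/10 < norm (c * f (- s + t))"
        using norm_triangle_ineq3[of "g t" "c * f (- s + t)"] by linarith
    qed
    have "emeasure \<mu> (B - E) \<le> emeasure \<mu> (B \<inter> (\<lambda>t. s + t) ` B \<union> B \<inter> (\<lambda>t. - s + t) ` B \<union> P \<union> Q \<union> (G - E))"
      by (intro emeasure_mono) (auto simp: G_def)
    also have "\<dots> \<le> emeasure \<mu> (B \<inter> (\<lambda>t. s + t) ` B) + emeasure \<mu> (B \<inter> (\<lambda>t. - s + t) ` B)
        + emeasure \<mu> P + emeasure \<mu> Q + emeasure \<mu> (G - E)"
      by (intro emeasure_subadditive[THEN order_trans] add_right_mono) auto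
    also have "\<dots> < ennreal (4 * e) + ennreal (4 * e) + ennreal e + ennreal e + ennreal e"
      by (intro add_strict_mono overlap overlap' P Q E)
    also have "\<dots> \<le> ennreal \<epsilon>" using e by (simp flip: ennreal_plus add: ennreal_leI)
    finally have small_diff: "emeasure \<mu> (B - E) < ennreal \<epsilon>" .
    have cancel: "ennreal (r powr p) * x < ennreal (\<epsilon> powr p)"
      if "ennreal ((r * (9/10)) powr p) * x < ennreal d'" "0 \<le> r" for r x
    proof -
      have "(r * (9/10)) powr p = (9/10) powr p * r powr p"
        using that(2) by (subst mult.commute, subst powr_mult) auto
      then have "ennreal ((9/10) powr p) * (ennreal (r powr p) * x) < ennreal d'"
        using that(1) by (simp only: ennreal_mult powr_ge_zero mult.assoc)
      also have "\<dots> \<le> ennreal ((9/10) powr p * \<epsilon> powr p)"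
        using \<epsilon> by (intro ennreal_leI, subst powr_mult[symmetric]) (auto simp: d'_def)
      finally show ?thesis
        using ennreal_less_divide_if_mult_less[of "(9/10) powr p"] by fastforce
    qed
    \<comment> \<open>On \<open>s + E\<close> the target \<open>g\<close> vanishes, so the scaled
      translate of \<open>f\<close>, of modulus at least \<open>norm c * (9/10)\<close>, is pure
      error.\<close>
    have "ennreal ((norm c * (9/10)) powr p) * emeasure weighted_measure ((\<lambda>t. s + t) ` E)
        \<le> modular (\<lambda>t. g t - c * f (- s + t))"
    proof (rule modular_ge_bound)
      fix t assume "t \<in> (\<lambda>t. s + t) ` E"
      then obtain u where u: "u \<in> E" "t = s + u" by blast
      then have "g t = 0" using E_trans(2)[OF u(1)] AB by (auto simp: g_def)
      moreover have "norm c * (9/10) \<le> norm c * norm (f u)"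
        using E_f[OF u(1)] by (intro mult_left_mono) auto
      ultimately show "norm c * (9/10) \<le> norm (g t - c * f (- s + t))"
        using u by (simp add: norm_mult add.assoc[symmetric])
    qed auto
    then have 1: "ennreal (norm c powr p) * emeasure weighted_measure ((\<lambda>t. s + t) ` E) < ennreal (\<epsilon> powr p)"
      using mg by (intro cancel) auto
    \<comment> \<open>On \<open>- s + E\<close> it is \<open>h\<close> that vanishes, and
      \<open>f\<close> itself is pure error: the modulus of \<open>c * f\<close> exceeds 9/10 there,
      because \<open>c * f (- s + u)\<close> is close to \<open>g u\<close> for \<open>u\<close> in
      \<open>E\<close>.\<close>
    have "ennreal ((1 / norm c * (9/10)) powr p) * emeasure weighted_measure ((\<lambda>t. - s + t) ` E)
        \<le> modular (\<lambda>t. h t - f t)"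
    proof (rule modular_ge_bound)
      fix t assume "t \<in> (\<lambda>t. - s + t) ` E"
      then obtain u where u: "u \<in> E" "t = - s + u" by blast
      then have "h t = 0" using E_trans(1)[OF u(1)] by (auto simp: h_def)
      moreover have "9/10 \<le> norm c * norm (f t)" using E_cf[OF u(1)] u(2) by (simp add: norm_mult)
      ultimately show "1 / norm c * (9/10) \<le> norm (h t - f t)"
        using c by (simp add: field_simps)
    qed auto
    then have 2: "ennreal ((1 / norm c) powr p) * emeasure weighted_measure ((\<lambda>t. - s + t) ` E) < ennreal (\<epsilon> powr p)"
      using mf by (intro cancel) auto
    show "\<exists>E. compact E \<and> E \<subseteq> B \<and> emeasure \<mu> (B - E) < ennreal \<epsilon> \<and>
     ennreal (norm c powr p) * emeasure weighted_measure ((\<lambda>t. s + t) ` E) < ennreal (\<epsilon> powr p) \<and>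
     ennreal ((1 / norm c) powr p) * emeasure weighted_measure ((\<lambda>t. - s + t) ` E) < ennreal (\<epsilon> powr p)"
      using E(1,2) \<open>G \<subseteq> B\<close> small_diff 1 2 by (intro exI[of _ E]) auto
  qed
qed

section \<open>From a dense vector to small translates\<close>

lemma dense_vector_approximates:
  assumes f: "dense_vector \<mu> p \<omega> \<Gamma> S f" and g: "compactly_bounded g" and d: "0 < d"
  obtains s c where "s \<in> S" "c \<in> \<Gamma>" "modular (\<lambda>t. g t - c * f (- s + t)) < ennreal d"
proof -
  have [measurable]: "f \<in> borel_measurable borel"
    using f by (simp add: dense_vector_def weighted_Lp_iff)
  have [measurable]: "g \<in> borel_measurable borel" using g by (rule compactly_bounded_measurable)
  have "g \<in> weighted_Lp \<mu> p \<omega>"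
    using compactly_bounded_modular[OF g] by (simp add: weighted_Lp_iff)
  moreover have "0 < d powr (1 / p)" using d by simp
  ultimately obtain s c where *: "s \<in> S" "c \<in> \<Gamma>"
    "weighted_norm \<mu> p \<omega> (\<lambda>t. g t - c * left_translation s f t) < ennreal (d powr (1 / p))"
    using f unfolding dense_vector_def dense_in_weighted_Lp_def by blast
  then have "modular (\<lambda>t. g t - c * f (- s + t)) < ennreal ((d powr (1 / p)) powr p)"
    using d by (subst (asm) weighted_norm_less_iff) (auto simp: left_translation_def)
  then show ?thesis using that[OF *(1,2)] d p_pos by (simp add: powr_powr)
qed

text \<open>
  Commutativity enters here: the translates of \<open>c' T\<^bsub>s'\<^esub> f\<close> are the images under \<open>c' T\<^bsub>s'\<^esub>\<close> of
  the translates of \<open>f\<close>, so one approximates the preimage of \<open>g\<close>.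
\<close>

lemma dense_vector_approximates_two:
  assumes f: "dense_vector \<mu> p \<omega> \<Gamma> S f" and h: "compactly_bounded h" and g: "compactly_bounded g"
    and pos: "0 < modular h" "0 < modular g" and d: "0 < d"
    and adm: "admissible_weight \<mu> S \<omega>" and comm: "\<And>s t. s \<in> S \<Longrightarrow> t \<in> S \<Longrightarrow> s + t = t + s"
  obtains f' s c where "f' \<in> borel_measurable borel" "s \<in> S" "c \<in> \<Gamma> - {0}"
    "modular (\<lambda>t. h t - f' t) < ennreal d" "modular (\<lambda>t. g t - c * f' (- s + t)) < ennreal d"
proof -
  have [measurable]: "f \<in> borel_measurable borel"
    using f by (simp add: dense_vector_def weighted_Lp_iff)
  have [measurable]: "g \<in> borel_measurable borel" using g by (rule compactly_bounded_measurable)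
  obtain x where x: "0 < x" "ennreal x \<le> modular h" using pos(1) by (rule pos_ennreal_ge_pos_real)
  obtain y where y: "0 < y" "ennreal y \<le> modular g" using pos(2) by (rule pos_ennreal_ge_pos_real)
  \<comment> \<open>Keeping \<open>e\<close> below the moduli of \<open>h\<close> and
    \<open>g\<close> forces both scalars to be nonzero: with the scalar 0 the error would be the
    full modular.\<close>
  define e where "e = min d (min x y)"
  have e: "0 < e" "e \<le> d" "e \<le> x" "e \<le> y" using d x y by (auto simp: e_def)
  obtain s' c' where 1: "s' \<in> S" "c' \<in> \<Gamma>" "modular (\<lambda>t. h t - c' * f (- s' + t)) < ennreal e"
    using dense_vector_approximates[OF f h e(1)] by metis
  have c': "c' \<noteq> 0"
  proof
    assume "c' = 0"
    then have "modular h < ennreal e" using 1(3) by simp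
    also have "\<dots> \<le> modular h" using order_trans[OF ennreal_leI[OF e(3)] x(2)] .
    finally show False by simp
  qed
  obtain L where L: "0 \<le> L" "\<And>f (c :: complex). f \<in> borel_measurable borel \<Longrightarrow>
       modular (\<lambda>t. c * f (- s' + t)) \<le> ennreal (norm c powr p * L) * modular f"
    using modular_translate_bound[OF adm 1(1)] by metis
  define b where "b = norm c' powr p * L"
  have b: "0 \<le> b" using L by (simp add: b_def)
  \<comment> \<open>The preimage of \<open>g\<close> under the translation by \<open>s'\<close>
    scaled by \<open>c'\<close>. It lies in the weighted space because \<open>g\<close> is bounded
    with compact support, although translation by \<open>- s'\<close> may be unbounded.\<close>
  define u where "u t = 1 / c' * g (- (- s') + t)" for t
  have u: "compactly_bounded u" unfolding u_def by (rule compactly_bounded_cmult_translate[OF g])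
  then have [measurable]: "u \<in> borel_measurable borel" by (rule compactly_bounded_measurable)
  have "0 < e / (b + 1)" using e b by simp
  from dense_vector_approximates[OF f u this] obtain s c where
    2: "s \<in> S" "c \<in> \<Gamma>" "modular (\<lambda>t. u t - c * f (- s + t)) < ennreal (e / (b + 1))" by metis
  have eq: "g t - c * (c' * f (- s' + (- s + t))) = c' * (u (- s' + t) - c * f (- s + (- s' + t)))" for t
  proof -
    have swap: "- s' + (- s + t) = - s + (- s' + t)"
      using comm[OF 1(1) 2(1)] by (metis add.assoc minus_add)
    have "u (- s' + t) = g t / c'" by (simp add: u_def add.assoc[symmetric])
    then show ?thesis unfolding swap using c' by (simp add: right_diff_distrib)
  qed
  have "modular (\<lambda>t. g t - c * (c' * f (- s' + (- s + t)))) \<le> ennreal b * modular (\<lambda>t. u t - c * f (- s + t))"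
    unfolding eq b_def by (rule L(2)[of "\<lambda>t. u t - c * f (- s + t)" c']) measurable
  also have "\<dots> \<le> ennreal b * ennreal (e / (b + 1))"
    using 2(3) by (intro mult_left_mono) auto
  also have "\<dots> = ennreal (b * (e / (b + 1)))" using b e by (intro ennreal_mult[symmetric]) auto
  also have "\<dots> < ennreal e" using b e by (intro ennreal_lessI) (auto simp: field_simps)
  finally have 3: "modular (\<lambda>t. g t - c * (c' * f (- s' + (- s + t)))) < ennreal e" .
  have c: "c \<noteq> 0"
  proof
    assume "c = 0"
    then have "modular g < ennreal e" using 3 by simp
    also have "\<dots> \<le> modular g" using order_trans[OF ennreal_leI[OF e(4)] y(2)] .
    finally show False by simp
  qed
  show ?thesis
  proof (rule that[of "\<lambda>t. c' * f (- s' + t)" s c])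
    show "(\<lambda>t. c' * f (- s' + t)) \<in> borel_measurable borel" by measurable
    show "s \<in> S" "c \<in> \<Gamma> - {0}" using 2 c by auto
    show "modular (\<lambda>t. h t - c' * f (- s' + t)) < ennreal d"
      using 1(3) ennreal_leI[OF e(2)] by (rule less_le_trans)
    show "modular (\<lambda>t. g t - c * (c' * f (- s' + (- s + t)))) < ennreal d"
      using 3 ennreal_leI[OF e(2)] by (rule less_le_trans)
  qed
qed

text \<open>The two-valued target requires a larger compact set \<open>B\<close> around
  \<open>F\<close>. The set \<open>E\<close> found in \<open>B\<close> is cut back to
  \<open>E \<inter> F\<close>, and the loss \<open>F - E\<close> is contained in
  \<open>B - E\<close>.\<close>

lemma small_translates_if_dense_vector:
  assumes nc: "\<not> compact (UNIV :: 'a set)" and f: "dense_vector \<mu> p \<omega> \<Gamma> S f"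
    and adm: "admissible_weight \<mu> S \<omega>" and comm: "\<And>s t. s \<in> S \<Longrightarrow> t \<in> S \<Longrightarrow> s + t = t + s"
  shows "small_translates S \<Gamma>"
  unfolding small_translates_def
proof (intro allI impI)
  fix F :: "'a set" and \<epsilon> :: real assume F: "compact F" and \<epsilon>: "0 < \<epsilon>"
  obtain A B where AB: "compact A" "compact B" "F \<subseteq> A" "A \<subseteq> B" "0 < emeasure \<mu> A" "0 < emeasure \<mu> (B - A)"
    by (rule compact_extension[OF nc F])
  have [measurable]: "A \<in> sets borel" "B \<in> sets borel" "F \<in> sets borel"
    using AB F by (auto intro: borel_compact)
  let ?h = "indicator B :: 'a \<Rightarrow> complex"
  let ?g = "\<lambda>t. if t \<in> A then 1 else if t \<in> B then 3 else 0 :: complex"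
  obtain d where d: "0 < d" "\<And>f s c. f \<in> borel_measurable borel \<Longrightarrow> c \<noteq> 0 \<Longrightarrow>
      modular (\<lambda>t. ?h t - f t) < ennreal d \<Longrightarrow> modular (\<lambda>t. ?g t - c * f (- s + t)) < ennreal d \<Longrightarrow>
    (\<exists>E. compact E \<and> E \<subseteq> B \<and> emeasure \<mu> (B - E) < ennreal \<epsilon> \<and>
     ennreal (norm c powr p) * emeasure weighted_measure ((\<lambda>t. s + t) ` E) < ennreal (\<epsilon> powr p) \<and>
     ennreal ((1 / norm c) powr p) * emeasure weighted_measure ((\<lambda>t. - s + t) ` E) < ennreal (\<epsilon> powr p))"
    using two_valued_target[OF AB(1,2,4-6) \<epsilon>] by blast
  have cb: "compactly_bounded ?h" "compactly_bounded ?g"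
    using AB by (auto intro!: compactly_boundedI[of _ 1 B] compactly_boundedI[of _ 3 B] split: split_indicator)
  \<comment> \<open>A \<nu>-null subset of a compact set is \<mu>-null, by the comparison of the two
    measures.\<close>
  have "0 < emeasure weighted_measure A"
  proof (rule ccontr)
    assume "\<not> 0 < emeasure weighted_measure A"
    then have "emeasure \<mu> A < ennreal e" if "0 < e" for e
      using haar_measure_small[OF AB(1) that] by auto
    then show False using AB(5) pos_ennreal_ge_pos_real[OF AB(5)] by (metis leD)
  qed
  moreover have "ennreal (1 powr p) * emeasure weighted_measure A \<le> modular ?h"
    "ennreal (1 powr p) * emeasure weighted_measure A \<le> modular ?g"
    using AB(4) by (intro modular_ge_bound; auto)+
  ultimately have pos: "0 < modular ?h" "0 < modular ?g" by (auto intro: less_le_trans)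
  obtain f' s c where *: "f' \<in> borel_measurable borel" "s \<in> S" "c \<in> \<Gamma> - {0}"
    "modular (\<lambda>t. ?h t - f' t) < ennreal d" "modular (\<lambda>t. ?g t - c * f' (- s + t)) < ennreal d"
    by (rule dense_vector_approximates_two[OF f cb pos d(1) adm comm])
  then obtain E where E: "compact E" "E \<subseteq> B" "emeasure \<mu> (B - E) < ennreal \<epsilon>"
     "ennreal (norm c powr p) * emeasure weighted_measure ((\<lambda>t. s + t) ` E) < ennreal (\<epsilon> powr p)"
     "ennreal ((1 / norm c) powr p) * emeasure weighted_measure ((\<lambda>t. - s + t) ` E) < ennreal (\<epsilon> powr p)"
    using d(2)[of f' c s] by auto
  have [measurable]: "E \<in> sets borel" using E(1) by (rule borel_compact)
  have sub: "ennreal x * emeasure weighted_measure ((\<lambda>t. r + t) ` (E \<inter> F)) < z"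
    if "ennreal x * emeasure weighted_measure ((\<lambda>t. r + t) ` E) < z" for x r z
    by (rule le_less_trans[OF _ that]) (auto intro!: mult_left_mono emeasure_mono)
  have "emeasure \<mu> (F - E \<inter> F) < ennreal \<epsilon>"
    by (rule le_less_trans[OF _ E(3)]) (use AB in \<open>auto intro!: emeasure_mono\<close>)
  moreover have "compact (E \<inter> F)" using E(1) F by (intro compact_Int)
  ultimately show "\<exists>s\<in>S. \<exists>c\<in>\<Gamma> - {0}. \<exists>E. compact E \<and> E \<subseteq> F \<and> emeasure \<mu> (F - E) < ennreal \<epsilon> \<and>
     ennreal (norm c powr p) * emeasure weighted_measure ((\<lambda>t. s + t) ` E) < ennreal (\<epsilon> powr p) \<and>
     ennreal ((1 / norm c) powr p) * emeasure weighted_measure ((\<lambda>t. - s + t) ` E) < ennreal (\<epsilon> powr p)"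
    using *(2,3) sub[OF E(4)] sub[OF E(5)] by (intro bexI[of _ s] bexI[of _ c] exI[of _ "E \<inter> F"]) auto
qed

subsection \<open>Separability\<close>

lemma modular_dominated_convergence:
  assumes [measurable]: "\<And>i. u i \<in> borel_measurable borel" "g \<in> borel_measurable borel" "w \<in> borel_measurable borel"
    and bound: "\<And>i t. norm (u i t) \<le> norm (w t)" and fin: "modular w < \<infinity>"
    and lim: "\<And>t. (\<lambda>i. u i t) \<longlonglongrightarrow> g t"
  shows "(\<lambda>i. modular (\<lambda>t. g t - u i t)) \<longlonglongrightarrow> 0"
proof -
  have g: "norm (g t) \<le> norm (w t)" for t
    by (rule tendsto_upperbound[OF tendsto_norm[OF lim]]) (auto simp: bound)
  have "(\<lambda>i. \<integral>\<^sup>+t. ennreal (norm (g t - u i t) powr p) \<partial>weighted_measure) \<longlonglongrightarrow> (\<integral>\<^sup>+t. 0 \<partial>weighted_measure)"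
  proof (rule nn_integral_dominated_convergence[where w = "\<lambda>t. ennreal (norm (2 * w t) powr p)"])
    have "norm (g t - u i t) \<le> norm (2 * w t)" for i t
      using g[of t] bound[of i t] norm_triangle_ineq4[of "g t" "u i t"] by (simp add: norm_mult)
    then show "AE t in weighted_measure. ennreal (norm (g t - u i t) powr p) \<le> ennreal (norm (2 * w t) powr p)" for i
      using p_pos by (intro AE_I2 ennreal_leI powr_mono2) auto
    show "(\<integral>\<^sup>+t. ennreal (norm (2 * w t) powr p) \<partial>weighted_measure) < \<infinity>"
      using modular_cmult[of w 2] fin by (simp add: modular_def ennreal_mult_less_top)
    show "AE t in weighted_measure. (\<lambda>i. ennreal (norm (g t - u i t) powr p)) \<longlonglongrightarrow> 0"
    proof (rule AE_I2)
      fix t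
      have "(\<lambda>i. norm (g t - u i t)) \<longlonglongrightarrow> 0"
        using tendsto_norm[OF tendsto_diff[OF tendsto_const[of "g t"] lim[of t]]] by simp
      then have "(\<lambda>i. norm (g t - u i t) powr p) \<longlonglongrightarrow> 0"
        using p_pos tendsto_powr'[of "\<lambda>i. norm (g t - u i t)" 0 sequentially "\<lambda>_. p" p] by auto
      then show "(\<lambda>i. ennreal (norm (g t - u i t) powr p)) \<longlonglongrightarrow> 0"
        using tendsto_ennrealI by fastforce
    qed
  qed measurable
  then show ?thesis by (simp add: modular_def)
qed

text \<open>Membership in the closure of \<open>D\<close> for the modular, with measurability
  included so that the modular rules apply.\<close>

definition approximable :: "('a \<Rightarrow> complex) set \<Rightarrow> ('a \<Rightarrow> complex) \<Rightarrow> bool" where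
  "approximable D g \<longleftrightarrow> g \<in> borel_measurable borel \<and> (\<forall>d>0. \<exists>h\<in>D. modular (\<lambda>t. g t - h t) < ennreal d)"

lemma approximable_measurable: "approximable D g \<Longrightarrow> g \<in> borel_measurable borel"
  by (simp add: approximable_def)

text \<open>In \<open>2 * 2 powr p\<close> the power undoes the constant of the triangle inequality
  and the factor 2 splits \<open>d\<close> into halves.\<close>

lemma modular_sum_less:
  assumes [measurable]: "f \<in> borel_measurable borel" "g \<in> borel_measurable borel"
    and "modular f < ennreal (d / (2 * 2 powr p))" "modular g < ennreal (d / (2 * 2 powr p))" "0 < d"
  shows "modular (\<lambda>t. f t + g t) < ennreal d"
proof -
  have "modular (\<lambda>t. f t + g t) \<le> ennreal (2 powr p) * (modular f + modular g)"
    by (rule modular_add_le) measurable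
  also have "\<dots> < ennreal (2 powr p) * (ennreal (d / (2 * 2 powr p)) + ennreal (d / (2 * 2 powr p)))"
    using assms by (intro ennreal_mult_strict_left_mono add_strict_mono) auto
  also have "\<dots> = ennreal d"
    using \<open>0 < d\<close> by (simp flip: ennreal_plus ennreal_mult')
  finally show ?thesis .
qed

lemma approximable_add:
  assumes D: "\<And>h k. h \<in> D \<Longrightarrow> k \<in> D \<Longrightarrow> (\<lambda>t. h t + k t) \<in> D"
    and meas: "\<And>h. h \<in> D \<Longrightarrow> h \<in> borel_measurable borel"
    and f: "approximable D f" and g: "approximable D g"
  shows "approximable D (\<lambda>t. f t + g t)"
  unfolding approximable_def
proof (intro conjI allI impI)
  have [measurable]: "f \<in> borel_measurable borel" "g \<in> borel_measurable borel"
    using f g by (auto simp: approximable_def)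
  show "(\<lambda>t. f t + g t) \<in> borel_measurable borel" by measurable
  fix d :: real assume d: "0 < d"
  then have "0 < d / (2 * 2 powr p)" by simp
  then obtain h k where h: "h \<in> D" "modular (\<lambda>t. f t - h t) < ennreal (d / (2 * 2 powr p))"
    and k: "k \<in> D" "modular (\<lambda>t. g t - k t) < ennreal (d / (2 * 2 powr p))"
    using f g unfolding approximable_def by metis
  have [measurable]: "h \<in> borel_measurable borel" "k \<in> borel_measurable borel" using meas h k by auto
  have "modular (\<lambda>t. (f t - h t) + (g t - k t)) < ennreal d"
    using h k d by (intro modular_sum_less) auto
  then show "\<exists>h\<in>D. modular (\<lambda>t. f t + g t - h t) < ennreal d"
    using D[OF h(1) k(1)] by (intro bexI[of _ "\<lambda>t. h t + k t"]) (auto simp: algebra_simps)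
qed

lemma approximable_zero: "(\<lambda>t. 0) \<in> D \<Longrightarrow> approximable D (\<lambda>t. 0)"
  unfolding approximable_def by (intro conjI allI impI bexI[of _ "\<lambda>t. 0"]) simp_all

lemma approximable_sum:
  assumes D: "\<And>h k. h \<in> D \<Longrightarrow> k \<in> D \<Longrightarrow> (\<lambda>t. h t + k t) \<in> D" "(\<lambda>t. 0) \<in> D"
    and meas: "\<And>h. h \<in> D \<Longrightarrow> h \<in> borel_measurable borel"
    and f: "\<And>i. i \<in> I \<Longrightarrow> approximable D (f i)"
  shows "approximable D (\<lambda>t. \<Sum>i\<in>I. f i t)"
  using f
proof (induction I rule: infinite_finite_induct)
  case (insert i I)
  have "approximable D (\<lambda>t. \<Sum>i\<in>I. f i t)"
    by (rule insert.IH, rule insert.prems) simp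
  then have "approximable D (\<lambda>t. f i t + (\<Sum>i\<in>I. f i t))"
    by (rule approximable_add[OF D(1) meas insert.prems[OF insertI1], rotated -1])
  then show ?case by (simp only: sum.insert[OF insert(1,2)])
qed (simp_all add: approximable_zero D(2))

lemma approximable_limit:
  assumes meas: "\<And>h. h \<in> D \<Longrightarrow> h \<in> borel_measurable borel"
    and u: "\<And>i. approximable D (u i)" and [measurable]: "g \<in> borel_measurable borel"
    and lim: "(\<lambda>i. modular (\<lambda>t. g t - u i t)) \<longlonglongrightarrow> 0"
  shows "approximable D g"
  unfolding approximable_def
proof (intro conjI allI impI)
  fix d :: real assume d: "0 < d"
  let ?e = "d / (2 * 2 powr p)"
  have "0 < ?e" using d by simp
  then have "\<forall>\<^sub>F i in sequentially. modular (\<lambda>t. g t - u i t) < ennreal ?e"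
    using lim by (intro order_tendstoD) auto
  then obtain i where i: "modular (\<lambda>t. g t - u i t) < ennreal ?e"
    by (auto simp: eventually_sequentially)
  obtain h where h: "h \<in> D" "modular (\<lambda>t. u i t - h t) < ennreal ?e"
    using u[of i] \<open>0 < ?e\<close> unfolding approximable_def by blast
  have [measurable]: "h \<in> borel_measurable borel" "u i \<in> borel_measurable borel"
    using meas[OF h(1)] approximable_measurable[OF u] by auto
  have "modular (\<lambda>t. (g t - u i t) + (u i t - h t)) < ennreal d"
    using i h d by (intro modular_sum_less) auto
  then show "\<exists>h\<in>D. modular (\<lambda>t. g t - h t) < ennreal d" using h(1) by auto
qed (rule assms)

text \<open>A Dynkin argument: the admissible sets \<open>A\<close> contain a pi-system and are
  closed under complements and disjoint countable unions. Intersecting with \<open>K\<close>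
  provides a majorant of finite modular for the limit step; \<open>c\<close> varies in the induction
  because complements use \<open>- c\<close>.\<close>

lemma approximable_indicator:
  assumes D: "\<And>h k. h \<in> D \<Longrightarrow> k \<in> D \<Longrightarrow> (\<lambda>t. h t + k t) \<in> D" "(\<lambda>t. 0) \<in> D"
    and meas: "\<And>h. h \<in> D \<Longrightarrow> h \<in> borel_measurable borel"
    and P: "Int_stable P" "UNIV \<in> P" "P \<subseteq> sets borel" "sigma_sets UNIV P = sets borel"
    and K: "compact K" and base: "\<And>B c. B \<in> P \<Longrightarrow> approximable D (\<lambda>t. c * indicator (K \<inter> B) t)"
    and A: "A \<in> sets borel"
  shows "approximable D (\<lambda>t. c * indicator (K \<inter> A) t)"
proof -
  have [measurable]: "K \<in> sets borel" using K by (rule borel_compact)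
  have "A \<in> sigma_sets UNIV P" using A P(4) by simp
  have "P \<subseteq> Pow UNIV" by simp
  from P(1) this \<open>A \<in> sigma_sets UNIV P\<close> show ?thesis
  proof (induction arbitrary: c rule: sigma_sets_induct_disjoint)
    case (basic A)
    then show ?case by (rule base)
  next
    case empty
    show ?case by (simp add: approximable_zero D(2))
  next
    case (compl A)
    have eq: "c * indicator (K \<inter> UNIV) t + (- c) * indicator (K \<inter> A) t = c * indicator (K \<inter> (UNIV - A)) t" for t
      by (auto split: split_indicator)
    have "approximable D (\<lambda>t. c * indicator (K \<inter> UNIV) t + (- c) * indicator (K \<inter> A) t)"
      by (rule approximable_add[OF D(1) meas base[OF P(2)] compl.IH])
    then show ?case by (simp only: eq)
  next
    case (union A)
    have [measurable]: "A i \<in> sets borel" for i using union P(4) by auto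
    have fin: "modular (\<lambda>t. c * indicator K t) < \<infinity>"
      by (intro compactly_bounded_modular compactly_boundedI[of _ "norm c" K] K)
         (auto split: split_indicator)
    have ind: "(\<Sum>i<n. c * indicator (K \<inter> A i) t) = c * indicator (K \<inter> (\<Union>i<n. A i)) t" for n t
    proof -
      have "(indicator (\<Union>i<n. A i) t :: complex) = (\<Sum>i<n. indicator (A i) t)"
        by (rule indicator_UN_disjoint) (auto intro: disjoint_family_on_mono[OF subset_UNIV union(1)])
      then show ?thesis by (simp only: indicator_inter_arith sum_distrib_left)
    qed
    show ?case
    proof (rule approximable_limit[OF meas])
      show "approximable D (\<lambda>t. \<Sum>i<n. c * indicator (K \<inter> A i) t)" for n
        by (intro approximable_sum[OF D meas] union.IH)
      show "(\<lambda>n. modular (\<lambda>t. c * indicator (K \<inter> (\<Union>i. A i)) t - (\<Sum>i<n. c * indicator (K \<inter> A i) t))) \<longlonglongrightarrow> 0"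
        unfolding ind
      proof (rule modular_dominated_convergence[OF _ _ _ _ fin])
        fix t
        have "\<forall>\<^sub>F n in sequentially. c * indicator (K \<inter> (\<Union>i<n. A i)) t = c * indicator (K \<inter> (\<Union>i. A i)) t"
        proof (cases "\<exists>i. t \<in> A i")
          case True
          then obtain i where "t \<in> A i" by blast
          then show ?thesis
            by (intro eventually_sequentiallyI[of "Suc i"]) (auto split: split_indicator)
        qed (auto split: split_indicator)
        then show "(\<lambda>n. c * indicator (K \<inter> (\<Union>i<n. A i)) t) \<longlonglongrightarrow> c * indicator (K \<inter> (\<Union>i. A i)) t"
          by (rule tendsto_eventually)
      qed (auto split: split_indicator)
    qed measurable
  qed
qed

text \<open>Simple functions converging to \<open>g\<close> and dominated by
  \<open>2 * norm (g t)\<close>, cut off by the exhaustion \<open>K i\<close>, converge to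
  \<open>g\<close> in the modular by dominated convergence.\<close>

lemma approximable_weighted_Lp:
  assumes D: "\<And>h k. h \<in> D \<Longrightarrow> k \<in> D \<Longrightarrow> (\<lambda>t. h t + k t) \<in> D" "(\<lambda>t. 0) \<in> D"
    and meas: "\<And>h. h \<in> D \<Longrightarrow> h \<in> borel_measurable borel"
    and K: "\<And>n. compact (K n)" "incseq K" "(\<Union>n. K n) = UNIV"
    and base: "\<And>n A c. A \<in> sets borel \<Longrightarrow> approximable D (\<lambda>t. c * indicator (K n \<inter> A) t)"
    and g[measurable]: "g \<in> borel_measurable borel" and fin: "modular g < \<infinity>"
  shows "approximable D g"
proof -
  have [measurable]: "K n \<in> sets borel" for n using K(1) by (rule borel_compact)
  obtain s where s: "\<And>i. simple_function borel (s i)" "\<And>t. (\<lambda>i. s i t) \<longlonglongrightarrow> g t"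
    "\<And>i t. norm (s i t) \<le> 2 * norm (g t)"
    using borel_measurable_implies_sequence_metric[OF g, of 0] by (auto simp: dist_norm)
  have [measurable]: "s i \<in> borel_measurable borel" for i by (rule borel_measurable_simple_function[OF s(1)])
  have rep: "s i t * indicator (K i) t = (\<Sum>y\<in>range (s i). y * indicator (K i \<inter> s i -` {y}) t)" for i t
  proof -
    have "s i t = (\<Sum>y\<in>range (s i). indicator (s i -` {y}) t *\<^sub>R y)"
      by (rule simple_function_indicator_representation_banach[OF s(1), unfolded space_borel Int_UNIV_right, OF UNIV_I])
    then have "s i t * indicator (K i) t = (\<Sum>y\<in>range (s i). indicator (s i -` {y}) t *\<^sub>R y) * indicator (K i) t"
      by (rule arg_cong)
    also have "\<dots> = (\<Sum>y\<in>range (s i). indicator (s i -` {y}) t *\<^sub>R y * indicator (K i) t)"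
      by (rule sum_distrib_right)
    also have "\<dots> = (\<Sum>y\<in>range (s i). y * indicator (K i \<inter> s i -` {y}) t)"
      by (intro sum.cong refl) (auto split: split_indicator)
    finally show ?thesis .
  qed
  show ?thesis
  proof (rule approximable_limit[OF meas])
    show "approximable D (\<lambda>t. s i t * indicator (K i) t)" for i
    proof -
      have [measurable]: "s i \<in> borel_measurable borel" by measurable
      have "s i -` {y} \<in> sets borel" for y
        using measurable_sets[OF \<open>s i \<in> borel_measurable borel\<close>, of "{y}"] by simp
      then show ?thesis unfolding rep by (intro approximable_sum[OF D meas] base)
    qed
    show "(\<lambda>i. modular (\<lambda>t. g t - s i t * indicator (K i) t)) \<longlonglongrightarrow> 0"
    proof (rule modular_dominated_convergence[where w = "\<lambda>t. 2 * g t"])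
      show "modular (\<lambda>t. 2 * g t) < \<infinity>" using fin by (simp add: modular_cmult ennreal_mult_less_top)
      show "norm (s i t * indicator (K i) t) \<le> norm (2 * g t)" for i t
        using s(3)[of i t] by (auto simp: norm_mult split: split_indicator)
      fix t
      have "t \<in> (\<Union>n. K n)" using K(3) by simp
      then obtain n where "t \<in> K n" by blast
      then have "\<forall>\<^sub>F i in sequentially. s i t = s i t * indicator (K i) t"
        using K(2) by (intro eventually_sequentiallyI[of n]) (auto simp: incseq_def split: split_indicator)
      then show "(\<lambda>i. s i t * indicator (K i) t) \<longlonglongrightarrow> g t"
        using s(2) by (rule Lim_transform_eventually[rotated])
    qed measurable
  qed (use g in auto)
qed

lemma countable_dense_compactly_bounded:
  obtains D where "countable D" "D \<noteq> {}" "\<And>h. h \<in> D \<Longrightarrow> compactly_bounded h"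
    "\<And>g. g \<in> borel_measurable borel \<Longrightarrow> modular g < \<infinity> \<Longrightarrow> approximable D g"
proof -
  obtain K :: "nat \<Rightarrow> 'a set" where K: "\<forall>n. compact (K n)" "incseq K" "(\<Union>n. K n) = UNIV"
    by (rule compact_exhaustion)
  have [measurable]: "K n \<in> sets borel" for n using K(1) by (auto intro: borel_compact)
  obtain P :: "'a set set" where P: "countable P" "Int_stable P" "UNIV \<in> P" "P \<subseteq> sets borel"
    "sigma_sets UNIV P = sets borel"
    by (rule countable_pi_system_borel)
  obtain Q :: "complex set" where Q: "countable Q" "\<And>X. open X \<Longrightarrow> X \<noteq> {} \<Longrightarrow> \<exists>q\<in>Q. q \<in> X"
    by (rule countable_dense_setE) blast
  define \<phi> where "\<phi> = (\<lambda>(q, n, B) t. q * indicator (K n \<inter> B) t :: complex)"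
  \<comment> \<open>Lists make the set countable and closed under addition by concatenation, with
    the empty list for 0, so \<open>Q\<close> may be any countable dense set of scalars.\<close>
  define D where "D = (\<lambda>l t. \<Sum>x\<leftarrow>l. \<phi> x t) ` lists (Q \<times> UNIV \<times> P)"
  have cb_\<phi>: "compactly_bounded (\<phi> x)" if "x \<in> Q \<times> UNIV \<times> P" for x
  proof -
    obtain q n B where x: "x = (q, n, B)" "B \<in> P" using \<open>x \<in> _\<close> by (cases x) auto
    then have [measurable]: "B \<in> sets borel" using P(4) by auto
    show ?thesis unfolding \<phi>_def x
      using K(1) by (auto intro!: compactly_boundedI[of _ "norm q" "K n"] split: split_indicator)
  qed
  have cb: "compactly_bounded h" if "h \<in> D" for h
  proof -
    have "compactly_bounded (\<lambda>t. \<Sum>x\<leftarrow>l. \<phi> x t)" if "l \<in> lists (Q \<times> UNIV \<times> P)" for l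
      using that
      by (induction rule: lists.induct) (auto simp: compactly_bounded_zero intro!: compactly_bounded_add cb_\<phi>)
    then show ?thesis using that by (auto simp: D_def)
  qed
  have add: "(\<lambda>t. h t + k t) \<in> D" if "h \<in> D" "k \<in> D" for h k
  proof -
    obtain l l' where "l \<in> lists (Q \<times> UNIV \<times> P)" "h = (\<lambda>t. \<Sum>x\<leftarrow>l. \<phi> x t)"
      "l' \<in> lists (Q \<times> UNIV \<times> P)" "k = (\<lambda>t. \<Sum>x\<leftarrow>l'. \<phi> x t)"
      using \<open>h \<in> D\<close> \<open>k \<in> D\<close> by (auto simp: D_def)
    then show ?thesis unfolding D_def by (intro image_eqI[of _ _ "l @ l'"]) auto
  qed
  have zero: "(\<lambda>t. 0) \<in> D" unfolding D_def by (intro image_eqI[of _ _ "[]"]) auto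
  have meas: "h \<in> borel_measurable borel" if "h \<in> D" for h
    using cb[OF that] by (rule compactly_bounded_measurable)
  have base: "approximable D (\<lambda>t. c * indicator (K n \<inter> B) t)" if "B \<in> P" for B c n
    unfolding approximable_def
  proof (intro conjI allI impI)
    have [measurable]: "B \<in> sets borel" using that P(4) by auto
    show "(\<lambda>t. c * indicator (K n \<inter> B) t) \<in> borel_measurable borel" by measurable
    fix d :: real assume d: "0 < d"
    obtain m where m: "0 \<le> m" "emeasure weighted_measure (K n) = ennreal m"
      using emeasure_weighted_measure_compact[of "K n"] K(1) by (cases "emeasure weighted_measure (K n)") auto
    \<comment> \<open>Its p-th power is \<open>d / (m + 1)\<close>; multiplied by the measure
      \<open>m\<close> of \<open>K n\<close> this stays strictly below \<open>d\<close>.\<close>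
    let ?r = "(d / (m + 1)) powr (1 / p)"
    have "0 < ?r" using d m by simp
    then obtain q where q: "q \<in> Q" "norm (c - q) < ?r"
      using Q(2)[of "ball c ?r"] by (auto simp: dist_norm)
    have "(\<lambda>t. q * indicator (K n \<inter> B) t) \<in> D"
      unfolding D_def by (intro image_eqI[of _ _ "[(q, n, B)]"]) (use q that in \<open>auto simp: \<phi>_def\<close>)
    moreover have "modular (\<lambda>t. c * indicator (K n \<inter> B) t - q * indicator (K n \<inter> B) t) < ennreal d"
    proof -
      have "modular (\<lambda>t. c * indicator (K n \<inter> B) t - q * indicator (K n \<inter> B) t)
          \<le> ennreal (norm (c - q) powr p) * emeasure weighted_measure (K n)"
        by (intro modular_le_bound) (auto split: split_indicator)
      also have "\<dots> = ennreal (norm (c - q) powr p * m)" using m by (simp add: ennreal_mult)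
      also have "\<dots> < ennreal d"
      proof (rule ennreal_lessI[OF d])
        have "norm (c - q) powr p \<le> ?r powr p" using q(2) p_pos by (intro powr_mono2) auto
        also have "\<dots> = d / (m + 1)" using d m p_pos by (simp add: powr_powr)
        finally have "norm (c - q) powr p * m \<le> d / (m + 1) * m" using m by (intro mult_right_mono) auto
        also have "\<dots> < d" using d m by (simp add: field_simps)
        finally show "norm (c - q) powr p * m < d" .
      qed
      finally show ?thesis .
    qed
    ultimately show "\<exists>h\<in>D. modular (\<lambda>t. c * indicator (K n \<inter> B) t - h t) < ennreal d"
      by (intro bexI[of _ "\<lambda>t. q * indicator (K n \<inter> B) t"])
  qed
  show ?thesis
  proof
    show "countable D" unfolding D_def using P(1) Q(1) by (intro countable_image countable_lists countable_SIGMA) auto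
    show "D \<noteq> {}" using zero by blast
    show "compactly_bounded h" if "h \<in> D" for h using that by (rule cb)
    fix g :: "'a \<Rightarrow> complex" assume g: "g \<in> borel_measurable borel" "modular g < \<infinity>"
    show "approximable D g"
    proof (rule approximable_weighted_Lp[OF add zero meas _ K(2,3) _ g])
      show "compact (K n)" for n using K(1) by blast
      then show "approximable D (\<lambda>t. c * indicator (K n \<inter> A) t)" if "A \<in> sets borel" for n A c
        using approximable_indicator[OF add zero meas P(2-5) _ base that] by blast
    qed auto
  qed
qed

subsection \<open>Construction of a dense vector\<close>

text \<open>The new function is \<open>u\<close> cut to \<open>E\<close> plus the inverse translate
  of \<open>h\<close> cut to \<open>E\<close>, divided by \<open>c\<close>. Its distance to
  \<open>u\<close> consists of a piece of \<open>u\<close> on \<open>F - E\<close> and of that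
  inverse translate. Applying translation by \<open>s\<close> and the factor \<open>c\<close>
  returns \<open>h\<close> on \<open>E\<close> and adds a translate of \<open>u\<close>, so the
  error is a piece of \<open>h\<close> on \<open>F - E\<close> and this translate.
  \<open>small_translates\<close> bounds exactly these terms.\<close>

lemma small_translates_step:
  assumes H: "small_translates S \<Gamma>" and u: "compactly_bounded u" and h: "compactly_bounded h" and d: "0 < d"
  obtains s c u' where "s \<in> S" "c \<in> \<Gamma> - {0}" "compactly_bounded u'"
    "modular (\<lambda>t. u' t - u t) < ennreal d" "modular (\<lambda>t. h t - c * u' (- s + t)) < ennreal d"
proof -
  obtain C1 K1 where u1: "0 \<le> C1" "\<And>t. norm (u t) \<le> C1" "compact K1" "\<And>t. t \<notin> K1 \<Longrightarrow> u t = 0"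
    using compactly_boundedE[OF u] by metis
  obtain C2 K2 where h1: "0 \<le> C2" "\<And>t. norm (h t) \<le> C2" "compact K2" "\<And>t. t \<notin> K2 \<Longrightarrow> h t = 0"
    using compactly_boundedE[OF h] by metis
  define C where "C = 1 + C1 + C2"
  define F where "F = K1 \<union> K2"
  have C: "1 \<le> C" "norm (u t) \<le> C" "norm (h t) \<le> C" for t
    using u1(1) u1(2)[of t] h1(1) h1(2)[of t] by (auto simp: C_def)
  have F: "compact F" and supp: "t \<notin> F \<Longrightarrow> u t = 0" "t \<notin> F \<Longrightarrow> h t = 0" for t
    using u1 h1 by (auto simp: F_def)
  have [measurable]: "F \<in> sets borel" using F by (rule borel_compact)
  have [measurable]: "u \<in> borel_measurable borel" "h \<in> borel_measurable borel"
    using u h by (auto intro: compactly_bounded_measurable)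
  \<comment> \<open>After multiplication by \<open>C powr p\<close>, the bound for the functions,
    this becomes half of \<open>d\<close> divided by the constant of the triangle
    inequality.\<close>
  define e where "e = d / (2 * 2 powr p) / C powr p"
  have e: "0 < e" using d C(1) by (simp add: e_def)
  have Ce: "ennreal (C powr p) * x < ennreal (d / (2 * 2 powr p))" if "x < ennreal e" for x
  proof -
    have "ennreal (C powr p) * x < ennreal (C powr p) * ennreal e"
      using that C(1) by (intro ennreal_mult_strict_left_mono) auto
    also have "\<dots> = ennreal (d / (2 * 2 powr p))"
      using C(1) d by (simp add: e_def flip: ennreal_mult')
    finally show ?thesis .
  qed
  obtain \<eta> where \<eta>: "0 < \<eta>" "\<And>A. A \<in> sets borel \<Longrightarrow> A \<subseteq> F \<Longrightarrow> emeasure \<mu> A < ennreal \<eta> \<Longrightarrow>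
      emeasure weighted_measure A < ennreal e"
    using weighted_measure_small[OF F e] by blast
  \<comment> \<open>The entry \<open>\<eta>\<close> makes \<open>F - E\<close> small for \<nu>; the
    other gives \<open>\<epsilon> powr p \<le> e\<close> for the translates.\<close>
  define \<epsilon> where "\<epsilon> = min \<eta> (e powr (1 / p))"
  have \<epsilon>: "0 < \<epsilon>" "\<epsilon> \<le> \<eta>" using \<eta> e by (auto simp: \<epsilon>_def)
  have "\<epsilon> powr p \<le> (e powr (1 / p)) powr p"
    using \<epsilon> p_pos by (intro powr_mono2) (auto simp: \<epsilon>_def)
  then have \<epsilon>p: "\<epsilon> powr p \<le> e" using e p_pos by (simp add: powr_powr)
  obtain s c E where *: "s \<in> S" "c \<in> \<Gamma> - {0}" "compact E" "E \<subseteq> F" "emeasure \<mu> (F - E) < ennreal \<epsilon>"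
    "ennreal (norm c powr p) * emeasure weighted_measure ((\<lambda>t. s + t) ` E) < ennreal (\<epsilon> powr p)"
    "ennreal ((1 / norm c) powr p) * emeasure weighted_measure ((\<lambda>t. - s + t) ` E) < ennreal (\<epsilon> powr p)"
    using H F \<epsilon>(1) unfolding small_translates_def by metis
  have [measurable]: "E \<in> sets borel" using *(3) by (rule borel_compact)
  have "emeasure weighted_measure (F - E) < ennreal e"
    using less_le_trans[OF *(5) ennreal_leI[OF \<epsilon>(2)]] by (intro \<eta>(2)) auto
  note FE = Ce[OF this]
  have cut: "modular (\<lambda>t. a * (v t * indicator (F - E) t)) < ennreal (d / (2 * 2 powr p))"
    if "\<And>t. norm (v t) \<le> C" "norm a = 1" for a and v :: "'a \<Rightarrow> complex"
    using that by (intro le_less_trans[OF modular_le_bound FE])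
      (auto simp: norm_mult split: split_indicator)
  have shift: "modular (\<lambda>t. a * (v (- r + t) * indicator E (- r + t))) < ennreal (d / (2 * 2 powr p))"
    if v: "\<And>t. norm (v t) \<le> C"
      and E: "ennreal (norm a powr p) * emeasure weighted_measure ((\<lambda>t. r + t) ` E) < ennreal (\<epsilon> powr p)"
    for a r and v :: "'a \<Rightarrow> complex"
  proof -
    have "modular (\<lambda>t. a * (v (- r + t) * indicator E (- r + t)))
        \<le> ennreal ((C * norm a) powr p) * emeasure weighted_measure ((\<lambda>t. r + t) ` E)"
    proof (rule modular_le_bound)
      fix t assume "t \<in> (\<lambda>t. r + t) ` E"
      then show "norm (a * (v (- r + t) * indicator E (- r + t))) \<le> C * norm a"
        using mult_left_mono[OF v[of "- r + t"], of "norm a"]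
        by (auto simp: norm_mult mult.commute split: split_indicator)
    next
      fix t assume "t \<notin> (\<lambda>t. r + t) ` E"
      then have "- r + t \<notin> E" using vimage_add_left[of "- r" E] by auto
      then show "a * (v (- r + t) * indicator E (- r + t)) = 0" by simp
    qed measurable
    also have "\<dots> = ennreal (C powr p) * (ennreal (norm a powr p) * emeasure weighted_measure ((\<lambda>t. r + t) ` E))"
      using C(1) by (simp add: powr_mult ennreal_mult mult.assoc)
    also have "\<dots> < ennreal (d / (2 * 2 powr p))"
      using less_le_trans[OF E ennreal_leI[OF \<epsilon>p]] by (rule Ce)
    finally show ?thesis .
  qed
  have cut_meas: "(\<lambda>t. a * (v t * indicator (F - E) t)) \<in> borel_measurable borel"
    and shift_meas: "(\<lambda>t. a * (v (- r + t) * indicator E (- r + t))) \<in> borel_measurable borel"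
    if [measurable]: "v \<in> borel_measurable borel" for a r and v :: "'a \<Rightarrow> complex"
    by measurable
  define u' where "u' t = u t * indicator E t + 1 / c * (h (- (- s) + t) * indicator E (- (- s) + t))" for t
  have c: "c \<noteq> 0" using *(2) by simp
  show ?thesis
  proof
    show "s \<in> S" "c \<in> \<Gamma> - {0}" by fact+
    show "compactly_bounded u'"
      unfolding u'_def
      by (intro compactly_bounded_add compactly_bounded_indicator u
          compactly_bounded_cmult_translate[where f = "\<lambda>t. h t * indicator E t"] h) measurable
    have eq: "u' t - u t = - 1 * (u t * indicator (F - E) t) + 1 / c * (h (- (- s) + t) * indicator E (- (- s) + t))" for t
      using supp(1)[of t] *(4) by (auto simp: u'_def split: split_indicator)
    show "modular (\<lambda>t. u' t - u t) < ennreal d"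
      unfolding eq
    proof (rule modular_sum_less)
      show "modular (\<lambda>t. 1 / c * (h (- (- s) + t) * indicator E (- (- s) + t))) < ennreal (d / (2 * 2 powr p))"
        using *(7) by (intro shift C) (simp add: norm_divide)
      show "modular (\<lambda>t. - 1 * (u t * indicator (F - E) t)) < ennreal (d / (2 * 2 powr p))"
        using C by (intro cut) auto
    qed (rule cut_meas shift_meas d; fact?)+
    have eq': "h t - c * u' (- s + t) = 1 * (h t * indicator (F - E) t) + (- c) * (u (- s + t) * indicator E (- s + t))" for t
    proof -
      have "- (- s) + (- s + t) = t" by (simp add: add.assoc[symmetric])
      then have "c * u' (- s + t) = c * (u (- s + t) * indicator E (- s + t)) + h t * indicator E t"
        unfolding u'_def using c by (simp only:) (simp add: distrib_left)
      moreover have "h t - h t * indicator E t = h t * indicator (F - E) t"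
        using supp(2)[of t] *(4) by (auto split: split_indicator)
      ultimately show ?thesis by (simp add: algebra_simps)
    qed
    show "modular (\<lambda>t. h t - c * u' (- s + t)) < ennreal d"
      unfolding eq'
    proof (rule modular_sum_less)
      show "modular (\<lambda>t. (- c) * (u (- s + t) * indicator E (- s + t))) < ennreal (d / (2 * 2 powr p))"
        using *(6) by (intro shift C) simp
      show "modular (\<lambda>t. 1 * (h t * indicator (F - E) t)) < ennreal (d / (2 * 2 powr p))"
        using C by (intro cut) auto
    qed (rule cut_meas shift_meas d; fact?)+
  qed
qed

text \<open>The base \<open>2 powr (- (p + 1))\<close> beats the weights
  \<open>2 powr (real m * p)\<close> of the pointwise estimate and leaves a geometric series of
  ratio 1/2. Monotonicity of \<open>L\<close> replaces each \<open>L (N + m)\<close> by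
  \<open>L N\<close>, which the factor on the left then cancels.\<close>

lemma modular_limit_le:
  assumes [measurable]: "\<And>n. u n \<in> borel_measurable borel" and L: "incseq L" "\<And>n. 1 \<le> L n"
    and step: "\<And>n. modular (\<lambda>t. u (Suc n) t - u n t) \<le> ennreal ((2 powr (- (p + 1))) ^ n / L n)"
  shows "ennreal (L N) * modular (\<lambda>t. lim (\<lambda>n. u n t) - u N t) \<le> ennreal (2 powr (p + 1) * (1 / 2) ^ N)"
proof -
  define q :: real where "q = 2 powr (- (p + 1))"
  have "q \<le> 2 powr (- 1)" unfolding q_def using p_pos by (intro powr_mono) auto
  then have q: "0 < q" "q \<le> 1 / 2" by (auto simp: q_def powr_minus_divide)
  have LN: "0 < L N" using L(2)[of N] by simp
  have "modular (\<lambda>t. lim (\<lambda>n. u n t) - u N t)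
      \<le> (\<integral>\<^sup>+t. ennreal (2 powr p) * (\<Sum>m. ennreal (2 powr (real m * p)) *
           ennreal (norm (u (Suc (N + m)) t - u (N + m) t) powr p)) \<partial>weighted_measure)"
    unfolding modular_def
  proof (rule nn_integral_mono)
    fix t
    show "ennreal (norm (lim (\<lambda>n. u n t) - u N t) powr p) \<le> ennreal (2 powr p) * (\<Sum>m. ennreal (2 powr (real m * p)) *
           ennreal (norm (u (Suc (N + m)) t - u (N + m) t) powr p))"
      using norm_lim_diff_powr_le[OF p_pos, of "\<lambda>m. u (N + m) t"] lim_shift[of "\<lambda>n. u n t" N] by simp
  qed
  also have "\<dots> = ennreal (2 powr p) * (\<Sum>m. ennreal (2 powr (real m * p)) * modular (\<lambda>t. u (Suc (N + m)) t - u (N + m) t))"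
    unfolding modular_def by (simp add: nn_integral_cmult nn_integral_suminf)
  also have "\<dots> \<le> ennreal (2 powr p) * (\<Sum>m. ennreal (q ^ N / L N * (1 / 2) ^ m))"
  proof (intro mult_left_mono suminf_le summableI)
    fix m
    have "ennreal (2 powr (real m * p)) * modular (\<lambda>t. u (Suc (N + m)) t - u (N + m) t)
        \<le> ennreal (2 powr (real m * p)) * ennreal (q ^ (N + m) / L (N + m))"
      unfolding q_def by (intro mult_left_mono step) auto
    also have "\<dots> = ennreal (2 powr (real m * p) * (q ^ (N + m) / L (N + m)))"
      using q L(2)[of "N + m"] by (intro ennreal_mult[symmetric]) auto
    also have "\<dots> \<le> ennreal (q ^ N / L N * (1 / 2) ^ m)"
    proof (rule ennreal_leI)
      have "2 powr (real m * p) = (2 powr p) ^ m"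
        by (simp add: powr_powr mult.commute flip: powr_realpow)
      then have "2 powr (real m * p) * q ^ m = (2 powr p * q) ^ m" by (simp add: power_mult_distrib)
      also have "2 powr p * q = 1 / 2" by (simp add: q_def flip: powr_add)
      finally have "2 powr (real m * p) * (q ^ (N + m) / L (N + m)) = q ^ N * (1 / 2) ^ m / L (N + m)"
        by (simp add: power_add mult_ac)
      also have "\<dots> \<le> q ^ N * (1 / 2) ^ m / L N"
        using q LN L(1) by (intro divide_left_mono mult_pos_pos) (auto simp: incseq_def intro: less_le_trans)
      finally show "2 powr (real m * p) * (q ^ (N + m) / L (N + m)) \<le> q ^ N / L N * (1 / 2) ^ m" by simp
    qed
    finally show "ennreal (2 powr (real m * p)) * modular (\<lambda>t. u (Suc (N + m)) t - u (N + m) t)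
        \<le> ennreal (q ^ N / L N * (1 / 2) ^ m)" .
  qed auto
  also have "(\<Sum>m. ennreal (q ^ N / L N * (1 / 2) ^ m)) = ennreal (q ^ N / L N * 2)"
    using q LN sums_mult[OF geometric_sums[of "1/2 :: real"], of "q ^ N / L N"]
    by (intro suminf_ennreal_eq) auto
  finally have "ennreal (L N) * modular (\<lambda>t. lim (\<lambda>n. u n t) - u N t)
      \<le> ennreal (L N) * (ennreal (2 powr p) * ennreal (q ^ N / L N * 2))"
    by (intro mult_left_mono) auto
  also have "\<dots> = ennreal (L N * (2 powr p * (q ^ N / L N * 2)))"
    using q LN by (simp add: ennreal_mult del: times_divide_eq_right times_divide_eq_left)
  also have "L N * (2 powr p * (q ^ N / L N * 2)) = 2 powr (p + 1) * q ^ N"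
    using LN by (simp add: powr_add)
  also have "\<dots> \<le> 2 powr (p + 1) * (1 / 2) ^ N"
    using q by (intro mult_left_mono power_mono) auto
  finally show ?thesis using ennreal_leI order_trans by blast
qed

text \<open>
  The increments of the approximants \<open>u n\<close> are kept below the reciprocal of the norms \<open>L n\<close> of all
  operators chosen so far, so that later corrections do not spoil earlier approximations.
\<close>

lemma dense_vector_if_small_translates:
  assumes H: "small_translates S \<Gamma>" and adm: "admissible_weight \<mu> S \<omega>"
  shows "\<exists>f. dense_vector \<mu> p \<omega> \<Gamma> S f"
proof -
  obtain D where D: "countable D" "D \<noteq> {}" "\<And>h. h \<in> D \<Longrightarrow> compactly_bounded h"
    "\<And>g. g \<in> borel_measurable borel \<Longrightarrow> modular g < \<infinity> \<Longrightarrow> approximable D g"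
    using countable_dense_compactly_bounded by metis
  \<comment> \<open>Each element of \<open>D\<close> occurs infinitely often in the enumeration \<open>h\<close>.\<close>
  define h where "h n = from_nat_into D (fst (prod_decode n))" for n
  have h: "compactly_bounded (h n)" for n
    unfolding h_def by (intro D(3) from_nat_into D(2))
  \<comment> \<open>A state is a pair of an approximant and a bound for the operators chosen so far.
    The operator chosen at stage \<open>n\<close> is bounded by the second component of the next
    state \<open>y\<close>, so only later increments are controlled by it.\<close>
  define Q where "Q n x y \<longleftrightarrow>
      modular (\<lambda>t. fst y t - fst x t) < ennreal ((2 powr (- (p + 1))) ^ n / snd x) \<and> snd x \<le> snd y \<and>
      (\<exists>s\<in>S. \<exists>c\<in>\<Gamma>. modular (\<lambda>t. h n t - c * fst y (- s + t)) < ennreal ((1 / 2) ^ n) \<and>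
        (\<forall>v\<in>borel_measurable borel. modular (\<lambda>t. c * v (- s + t)) \<le> ennreal (snd y) * modular v))"
    for n and x y :: "('a \<Rightarrow> complex) \<times> real"
  have "\<exists>x. \<forall>n. (compactly_bounded (fst (x n)) \<and> 1 \<le> snd (x n)) \<and> Q n (x n) (x (Suc n))"
  proof (rule dependent_nat_choice)
    show "\<exists>x :: _ \<times> real. compactly_bounded (fst x) \<and> 1 \<le> snd x"
      by (intro exI[of _ "(\<lambda>t. 0, 1)"]) (auto simp: compactly_bounded_zero)
    fix x :: "('a \<Rightarrow> complex) \<times> real" and n
    assume x: "compactly_bounded (fst x) \<and> 1 \<le> snd x"
    let ?a = "(2 powr (- (p + 1))) ^ n / snd x"
    have "0 < min ?a ((1 / 2) ^ n)" using x by auto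
    then obtain s c u' where *: "s \<in> S" "c \<in> \<Gamma> - {0}" "compactly_bounded u'"
      "modular (\<lambda>t. u' t - fst x t) < ennreal (min ?a ((1 / 2) ^ n))"
      "modular (\<lambda>t. h n t - c * u' (- s + t)) < ennreal (min ?a ((1 / 2) ^ n))"
      by (rule small_translates_step[OF H conjunct1[OF x] h])
    obtain L where L: "0 \<le> L" "\<And>v (c :: complex). v \<in> borel_measurable borel \<Longrightarrow>
       modular (\<lambda>t. c * v (- s + t)) \<le> ennreal (norm c powr p * L) * modular v"
      using modular_translate_bound[OF adm *(1)] by metis
    define L' where "L' = max (snd x) (norm c powr p * L)"
    have "modular (\<lambda>t. c * v (- s + t)) \<le> ennreal L' * modular v" if "v \<in> borel_measurable borel" for v
      by (rule order_trans[OF L(2)[OF that]]) (intro mult_right_mono ennreal_leI, auto simp: L'_def)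
    moreover have "modular (\<lambda>t. u' t - fst x t) < ennreal ?a"
      using *(4) by (rule less_le_trans) (intro ennreal_leI, simp)
    moreover have "modular (\<lambda>t. h n t - c * u' (- s + t)) < ennreal ((1 / 2) ^ n)"
      using *(5) by (rule less_le_trans) (intro ennreal_leI, simp)
    ultimately have "Q n x (u', L')"
      using *(1,2) unfolding Q_def by (auto simp: L'_def)
    moreover have "1 \<le> L'" using x by (auto simp: L'_def)
    ultimately show "\<exists>y. (compactly_bounded (fst y) \<and> 1 \<le> snd y) \<and> Q n x y"
      using *(3) by (intro exI[of _ "(u', L')"]) auto
  qed
  then obtain x where x: "\<And>n. compactly_bounded (fst (x n))" "\<And>n. 1 \<le> snd (x n)" "\<And>n. Q n (x n) (x (Suc n))"
    by blast
  define u where "u n = fst (x n)" for n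
  define L where "L n = snd (x n)" for n
  have [measurable]: "u n \<in> borel_measurable borel" for n
    using x(1) by (simp add: u_def compactly_bounded_measurable)
  have L: "incseq L" "1 \<le> L n" for n
    using x(2,3) by (auto simp: L_def Q_def intro!: incseq_SucI)
  have step: "modular (\<lambda>t. u (Suc n) t - u n t) \<le> ennreal ((2 powr (- (p + 1))) ^ n / L n)" for n
    using x(3)[of n] by (auto simp: Q_def u_def L_def)
  define f where "f t = lim (\<lambda>n. u n t)" for t
  have [measurable]: "f \<in> borel_measurable borel" unfolding f_def by measurable
  have tail: "ennreal (L n) * modular (\<lambda>t. f t - u n t) \<le> ennreal (2 powr (p + 1) * (1 / 2) ^ n)" for n
    unfolding f_def using L step by (intro modular_limit_le) auto
  have f_fin: "modular f < \<infinity>"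
  proof -
    have "modular (\<lambda>t. f t - u 0 t) \<le> ennreal (L 0) * modular (\<lambda>t. f t - u 0 t)"
      using L(2)[of 0] mult_right_mono[of 1 "ennreal (L 0)" "modular (\<lambda>t. f t - u 0 t)"] by simp
    also note tail[of 0]
    finally have "modular (\<lambda>t. f t - u 0 t) < \<infinity>" by (rule le_less_trans) simp
    moreover have "modular (u 0) < \<infinity>" unfolding u_def by (intro compactly_bounded_modular x)
    ultimately have "ennreal (2 powr p) * (modular (\<lambda>t. f t - u 0 t) + modular (u 0)) < \<infinity>"
      by (simp add: ennreal_mult_less_top)
    moreover have "modular (\<lambda>t. (f t - u 0 t) + u 0 t) \<le> ennreal (2 powr p) * (modular (\<lambda>t. f t - u 0 t) + modular (u 0))"
      by (rule modular_add_le) measurable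
    ultimately show ?thesis by simp
  qed
  \<comment> \<open>The operator of stage \<open>n\<close> brings \<open>u (Suc n)\<close> within
    \<open>(1 / 2) ^ n\<close> of \<open>h n\<close>. Replacing \<open>u (Suc n)\<close> by
    \<open>f\<close> costs \<open>L (Suc n)\<close> times a tail, which is the product estimated by
    \<open>tail\<close>.\<close>
  have near: "\<exists>s\<in>S. \<exists>c\<in>\<Gamma>. modular (\<lambda>t. h n t - c * f (- s + t)) \<le> ennreal (2 powr p * (1 + 2 powr p) * (1 / 2) ^ n)" for n
  proof -
    obtain s c where sc: "s \<in> S" "c \<in> \<Gamma>" "modular (\<lambda>t. h n t - c * u (Suc n) (- s + t)) < ennreal ((1 / 2) ^ n)"
      "\<And>v. v \<in> borel_measurable borel \<Longrightarrow> modular (\<lambda>t. c * v (- s + t)) \<le> ennreal (L (Suc n)) * modular v"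
      using x(3)[of n] by (auto simp: Q_def u_def L_def)
    have [measurable]: "h n \<in> borel_measurable borel" using h by (rule compactly_bounded_measurable)
    have "modular (\<lambda>t. c * (u (Suc n) (- s + t) - f (- s + t))) \<le> ennreal (L (Suc n)) * modular (\<lambda>t. u (Suc n) t - f t)"
      by (rule sc(4)) measurable
    also have "modular (\<lambda>t. u (Suc n) t - f t) = modular (\<lambda>t. f t - u (Suc n) t)"
      by (intro modular_cong_norm norm_minus_commute)
    also note tail[of "Suc n"]
    also have "2 powr (p + 1) * (1 / 2) ^ Suc n = 2 powr p * (1 / 2) ^ n" by (simp add: powr_add)
    finally have 2: "modular (\<lambda>t. c * u (Suc n) (- s + t) - c * f (- s + t)) \<le> ennreal (2 powr p * (1 / 2) ^ n)"
      by (simp add: right_diff_distrib)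
    have "modular (\<lambda>t. h n t - c * f (- s + t)) \<le> ennreal (2 powr p) *
        (modular (\<lambda>t. h n t - c * u (Suc n) (- s + t)) + modular (\<lambda>t. c * u (Suc n) (- s + t) - c * f (- s + t)))"
      by (rule modular_diff_triangle) measurable
    also have "\<dots> \<le> ennreal (2 powr p) * (ennreal ((1 / 2) ^ n) + ennreal (2 powr p * (1 / 2) ^ n))"
      using sc(3) 2 by (intro mult_left_mono add_mono) auto
    also have "\<dots> = ennreal (2 powr p * ((1 / 2) ^ n + 2 powr p * (1 / 2) ^ n))"
      by (simp add: ennreal_mult ennreal_plus)
    also have "2 powr p * ((1 / 2) ^ n + 2 powr p * (1 / 2) ^ n) = 2 powr p * (1 + 2 powr p) * (1 / 2) ^ n"
      by (simp add: algebra_simps)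
    finally show ?thesis using sc(1,2) by blast
  qed
  have orbit: "(\<lambda>t. c * left_translation s f t) \<in> weighted_Lp \<mu> p \<omega>" if s: "s \<in> S" for s c
  proof -
    obtain M where M: "\<And>v (c :: complex). v \<in> borel_measurable borel \<Longrightarrow>
       modular (\<lambda>t. c * v (- s + t)) \<le> ennreal (norm c powr p * M) * modular v"
      using modular_translate_bound[OF adm s] by metis
    have "modular (\<lambda>t. c * f (- s + t)) \<le> ennreal (norm c powr p * M) * modular f"
      by (rule M) measurable
    also have "\<dots> < \<infinity>" using f_fin by (simp add: ennreal_mult_less_top)
    finally show ?thesis by (simp add: weighted_Lp_iff left_translation_def)
  qed
  have "\<exists>k\<in>{\<lambda>t. c * left_translation s f t | c s. c \<in> \<Gamma> \<and> s \<in> S}.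
      weighted_norm \<mu> p \<omega> (\<lambda>t. g t - k t) < ennreal \<epsilon>"
    if g: "g \<in> weighted_Lp \<mu> p \<omega>" and \<epsilon>: "0 < \<epsilon>" for g \<epsilon>
  proof -
    have [measurable]: "g \<in> borel_measurable borel" and g_fin: "modular g < \<infinity>"
      using g by (auto simp: weighted_Lp_iff)
    define e where "e = \<epsilon> powr p / (2 * 2 powr p)"
    have e: "0 < e" using \<epsilon> by (simp add: e_def)
    obtain k where k: "k \<in> D" "modular (\<lambda>t. g t - k t) < ennreal e"
      using D(4)[OF \<open>g \<in> borel_measurable borel\<close> g_fin] e unfolding approximable_def by blast
    obtain i where i: "from_nat_into D i = k" using from_nat_into_surj[OF D(1) k(1)] by blast
    have "(\<lambda>n. 2 powr p * (1 + 2 powr p) * (1 / 2 :: real) ^ n) \<longlonglongrightarrow> 2 powr p * (1 + 2 powr p) * 0"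
      by (intro tendsto_mult tendsto_const LIMSEQ_realpow_zero) auto
    then have "\<forall>\<^sub>F n in sequentially. 2 powr p * (1 + 2 powr p) * (1 / 2 :: real) ^ n < e"
      using e by (intro order_tendstoD) auto
    then obtain j where j: "\<And>n. n \<ge> j \<Longrightarrow> 2 powr p * (1 + 2 powr p) * (1 / 2 :: real) ^ n < e"
      by (auto simp: eventually_sequentially)
    \<comment> \<open>Among the infinitely many positions of \<open>k\<close> in the enumeration,
      one beyond \<open>j\<close> is taken, so that the error of that stage is below
      \<open>e\<close>.\<close>
    define n where "n = prod_encode (i, j)"
    have hn: "h n = k" by (simp add: h_def n_def i)
    have "j \<le> n" unfolding n_def by (rule le_prod_encode_2)
    obtain s c where sc: "s \<in> S" "c \<in> \<Gamma>"
      "modular (\<lambda>t. k t - c * f (- s + t)) \<le> ennreal (2 powr p * (1 + 2 powr p) * (1 / 2) ^ n)"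
      using near[of n] unfolding hn by blast
    note sc(3)
    also have "ennreal (2 powr p * (1 + 2 powr p) * (1 / 2) ^ n) < ennreal e"
      using j[OF \<open>j \<le> n\<close>] e by (intro ennreal_lessI)
    finally have kf: "modular (\<lambda>t. k t - c * f (- s + t)) < ennreal e" .
    have [measurable]: "k \<in> borel_measurable borel" using D(3)[OF k(1)] by (rule compactly_bounded_measurable)
    have "modular (\<lambda>t. (g t - k t) + (k t - c * f (- s + t))) < ennreal (\<epsilon> powr p)"
      using k(2) kf \<epsilon> by (intro modular_sum_less) (auto simp: e_def)
    then have "weighted_norm \<mu> p \<omega> (\<lambda>t. g t - c * left_translation s f t) < ennreal \<epsilon>"
      using \<epsilon> by (subst weighted_norm_less_iff) (auto simp: left_translation_def)
    then show ?thesis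
      using sc(1,2) by (intro bexI[of _ "\<lambda>t. c * left_translation s f t"]) auto
  qed
  then have "dense_vector \<mu> p \<omega> \<Gamma> S f"
    unfolding dense_vector_def dense_in_weighted_Lp_def
    using orbit f_fin by (auto simp: weighted_Lp_iff)
  then show ?thesis by blast
qed

end

theorem theoremB:
  fixes \<mu> :: "'a::{topological_group_add, t2_space, second_countable_topology} measure"
    and S :: "'a set" and p :: real and \<Gamma> :: "complex set" and \<omega> :: "'a \<Rightarrow> real"
  assumes "locally_compact_space (euclidean :: 'a topology)"
    and "\<not> compact (UNIV :: 'a set)"
    and "left_haar_measure \<mu>"
    and "1 \<le> p"
    and "\<Gamma> - {0} \<noteq> {}"
    and "weight \<mu> \<omega>"
    and "locally_p_integrable \<mu> p \<omega>"
    and "admissible_weight \<mu> S \<omega>"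
    and "is_abelian (subgroup_generated_by S)"
  defines "cond1 \<equiv> \<exists>f. dense_vector \<mu> p \<omega> \<Gamma> S f"
    and "cond2 \<equiv> \<forall>F. compact F \<longrightarrow> (\<forall>\<epsilon>>0. \<exists>s\<in>S. \<exists>c\<in>\<Gamma> - {0}. \<exists>E. compact E \<and> E \<subseteq> F \<and>
          emeasure \<mu> (F - E) < ennreal \<epsilon> \<and>
          ennreal (norm c) * ess_sup_on \<mu> E (\<lambda>t. \<omega> (s + t)) < ennreal \<epsilon> \<and>
          ennreal (1 / norm c) * ess_sup_on \<mu> E (\<lambda>t. \<omega> (- s + t)) < ennreal \<epsilon>)"
    and "cond3 \<equiv> \<forall>F. compact F \<longrightarrow> (\<forall>\<epsilon>>0. \<exists>s\<in>S. \<exists>c\<in>\<Gamma> - {0}. \<exists>E. compact E \<and> E \<subseteq> F \<and>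
          emeasure \<mu> (F - E) < ennreal \<epsilon> \<and>
          ennreal (norm c) * p_norm_on \<mu> p ((\<lambda>t. s + t) ` E) \<omega> < ennreal \<epsilon> \<and>
          ennreal (1 / norm c) * p_norm_on \<mu> p ((\<lambda>t. - s + t) ` E) \<omega> < ennreal \<epsilon>)"
  shows "(cond1 \<longleftrightarrow> cond2) \<and> (cond2 \<longleftrightarrow> cond3)"
proof -
  interpret weighted_group \<mu> p \<omega>
    using assms(1,3,4,6,7) by unfold_locales auto
  have "cond3 \<longleftrightarrow> small_translates S \<Gamma>"
    unfolding cond3_def small_translates_iff_p_norm ..
  moreover have "cond2 \<longleftrightarrow> small_translates S \<Gamma>"
  proof
    assume cond2
    then show "small_translates S \<Gamma>" unfolding cond2_def by (rule small_translates_if_ess_sup)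
  next
    assume "small_translates S \<Gamma>"
    then show cond2 unfolding cond2_def using ess_sup_if_small_translates by blast
  qed
  moreover have "cond1 \<longleftrightarrow> small_translates S \<Gamma>"
  proof
    assume cond1
    then obtain f where "dense_vector \<mu> p \<omega> \<Gamma> S f" unfolding cond1_def by blast
    then show "small_translates S \<Gamma>"
      by (rule small_translates_if_dense_vector[OF assms(2) _ assms(8)])
         (rule abelian_generated_commute[OF assms(9)])
  next
    assume "small_translates S \<Gamma>"
    then show cond1 unfolding cond1_def using assms(8) by (rule dense_vector_if_small_translates)
  qed
  ultimately show ?thesis by simp
qed

end
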